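(* Let $N\in\mathbb{N}$, $N>n_1$, and let $\xi^{1(1)},\dots,\xi^{1(N)}$ be independent samples of $\xi^1$ drawn according to the probability distribution $\Pr$ on $\Xi^1$. Consider the scenario with certificates problem $$\mathrm{SwC}_2^N := \min_{x^1,\gamma,x^2_1,\dots,x^2_N}\ \gamma$$ subject to $Ax^1=h^1$, $x^1\ge 0$, and, for $i=1,\dots,N$, $$c^{1\top}x^1+c^{2\top}(\xi^{1(i)})x_i^2\le\gamma,\qquad T^1(\xi^{1(i)})x^1+W^2(\xi^{1(i)})x_i^2=h^2(\xi^{1(i)}),\qquad x_i^2\ge 0.$$ Assume that, for any multisample extraction, $\mathrm{SwC}_2^N$ is feasible and attains a unique optimal solution, denoted (in terms of its design variables) $(\hat x_N^1,\hat\gamma_N)$. Then, given an accuracy level $\epsilon\in(0,1)$, $$\Pr\{V_2(\hat x_N^1,\hat\gamma_N)>\epsilon\}\le B(N,\epsilon,n_1+1),\qquad B(N,\epsilon,n_1+1):=\sum_{k=0}^{n_1}\binom{N}{k}\epsilon^k(1-\epsilon)^{N-k},$$ where the outer probability is with respect to the extraction of the $N$ independent samples and $V_2$ is the violation probability.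
   Context: $\xi^1$ is a random parameter with support $\Xi^1\subseteq\mathbb{R}^{n_1}$ and probability distribution $\Pr$. The vectors $c^1\in\mathbb{R}^{n_1}$, $h^1\in\mathbb{R}^{m_1}$ and the matrix $A\in\mathbb{R}^{m_1\times n_1}$ are known. For each $\xi^1\in\Xi^1$, $c^2(\xi^1)\in\mathbb{R}^{n_2}$, $h^2(\xi^1)\in\mathbb{R}^{m_2}$, $T^1(\xi^1)\in\mathbb{R}^{m_2\times n_1}$, $W^2(\xi^1)\in\mathbb{R}^{m_2\times n_2}$. The design variables are $x^1\in\mathbb{R}^{n_1}$ and $\gamma\in\mathbb{R}$; the certificates are $x_i^2\in\mathbb{R}^{n_2}$, one per sample. The violation probability of $(x^1,\gamma)$ is $$V_2(x^1,\gamma):=\Pr\Big\{\xi^1\in\Xi^1:\ \nexists\, x^2(\xi^1)\in\mathbb{R}^{n_2}_+ \text{ with } c^{1\top}x^1+c^{2\top}(\xi^1)x^2(\xi^1)\le\gamma \text{ and } T^1(\xi^1)x^1+W^2(\xi^1)x^2(\xi^1)=h^2(\xi^1)\Big\}.$$ *)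

theory Defs
  imports "HOL-Probability.Probability"
begin

text \<open>
  The inequality \<open>0 \<le> x\<close> between vectors in \<open>real ^ 'n\<close> is the componentwise order of the library.
\<close>

definition is_certificate ::
  "real ^ 'n1 \<Rightarrow> ('s \<Rightarrow> real ^ 'n2) \<Rightarrow> ('s \<Rightarrow> real ^ 'n1 ^ 'm2) \<Rightarrow> ('s \<Rightarrow> real ^ 'n2 ^ 'm2)
    \<Rightarrow> ('s \<Rightarrow> real ^ 'm2) \<Rightarrow> 's \<Rightarrow> real ^ 'n1 \<Rightarrow> real \<Rightarrow> real ^ 'n2 \<Rightarrow> bool"
  where
  "is_certificate c1 c2 T1 W2 h2 \<xi> x1 \<gamma> x2 \<longleftrightarrow>
     c1 \<bullet> x1 + c2 \<xi> \<bullet> x2 \<le> \<gamma> \<and> T1 \<xi> *v x1 + W2 \<xi> *v x2 = h2 \<xi> \<and> 0 \<le> x2"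

definition violation_prob ::
  "'s measure \<Rightarrow> real ^ 'n1 \<Rightarrow> ('s \<Rightarrow> real ^ 'n2) \<Rightarrow> ('s \<Rightarrow> real ^ 'n1 ^ 'm2) \<Rightarrow> ('s \<Rightarrow> real ^ 'n2 ^ 'm2)
    \<Rightarrow> ('s \<Rightarrow> real ^ 'm2) \<Rightarrow> (real ^ 'n1) \<times> real \<Rightarrow> real"
  where
  "violation_prob P c1 c2 T1 W2 h2 = (\<lambda>(x1, \<gamma>).
     measure P {\<xi> \<in> space P. \<not> (\<exists>x2. is_certificate c1 c2 T1 W2 h2 \<xi> x1 \<gamma> x2)})"

definition SwC_feasible ::
  "real ^ 'n1 ^ 'm1 \<Rightarrow> real ^ 'm1 \<Rightarrow> real ^ 'n1 \<Rightarrow> ('s \<Rightarrow> real ^ 'n2) \<Rightarrow> ('s \<Rightarrow> real ^ 'n1 ^ 'm2)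
    \<Rightarrow> ('s \<Rightarrow> real ^ 'n2 ^ 'm2) \<Rightarrow> ('s \<Rightarrow> real ^ 'm2) \<Rightarrow> nat \<Rightarrow> (nat \<Rightarrow> 's)
    \<Rightarrow> real ^ 'n1 \<Rightarrow> real \<Rightarrow> (nat \<Rightarrow> real ^ 'n2) \<Rightarrow> bool"
  where
  "SwC_feasible A h1 c1 c2 T1 W2 h2 N \<omega> x1 \<gamma> x2 \<longleftrightarrow>
     A *v x1 = h1 \<and> 0 \<le> x1 \<and>
     (\<forall>i\<in>{1..N}. is_certificate c1 c2 T1 W2 h2 (\<omega> i) x1 \<gamma> (x2 i))"

definition SwC_optimal ::
  "real ^ 'n1 ^ 'm1 \<Rightarrow> real ^ 'm1 \<Rightarrow> real ^ 'n1 \<Rightarrow> ('s \<Rightarrow> real ^ 'n2) \<Rightarrow> ('s \<Rightarrow> real ^ 'n1 ^ 'm2)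
    \<Rightarrow> ('s \<Rightarrow> real ^ 'n2 ^ 'm2) \<Rightarrow> ('s \<Rightarrow> real ^ 'm2) \<Rightarrow> nat \<Rightarrow> (nat \<Rightarrow> 's)
    \<Rightarrow> real ^ 'n1 \<Rightarrow> real \<Rightarrow> (nat \<Rightarrow> real ^ 'n2) \<Rightarrow> bool"
  where
  "SwC_optimal A h1 c1 c2 T1 W2 h2 N \<omega> x1 \<gamma> x2 \<longleftrightarrow>
     SwC_feasible A h1 c1 c2 T1 W2 h2 N \<omega> x1 \<gamma> x2 \<and>
     (\<forall>y1 \<delta> y2. SwC_feasible A h1 c1 c2 T1 W2 h2 N \<omega> y1 \<delta> y2 \<longrightarrow> \<gamma> \<le> \<delta>)"

text \<open>
  The design-variable part of an optimal solution. Uniqueness of the optimal solution is always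
  meant at this level: the certificates \<open>x2 1, \<dots>, x2 N\<close> of an optimal solution need not be unique
  (the cost constraint of a sample can be slack).
\<close>

definition SwC_optimal_design ::
  "real ^ 'n1 ^ 'm1 \<Rightarrow> real ^ 'm1 \<Rightarrow> real ^ 'n1 \<Rightarrow> ('s \<Rightarrow> real ^ 'n2) \<Rightarrow> ('s \<Rightarrow> real ^ 'n1 ^ 'm2)
    \<Rightarrow> ('s \<Rightarrow> real ^ 'n2 ^ 'm2) \<Rightarrow> ('s \<Rightarrow> real ^ 'm2) \<Rightarrow> nat \<Rightarrow> (nat \<Rightarrow> 's)
    \<Rightarrow> (real ^ 'n1) \<times> real \<Rightarrow> bool"
  where
  "SwC_optimal_design A h1 c1 c2 T1 W2 h2 N \<omega> = (\<lambda>(x1, \<gamma>).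
     \<exists>x2. SwC_optimal A h1 c1 c2 T1 W2 h2 N \<omega> x1 \<gamma> x2)"

definition SwC_solution ::
  "real ^ 'n1 ^ 'm1 \<Rightarrow> real ^ 'm1 \<Rightarrow> real ^ 'n1 \<Rightarrow> ('s \<Rightarrow> real ^ 'n2) \<Rightarrow> ('s \<Rightarrow> real ^ 'n1 ^ 'm2)
    \<Rightarrow> ('s \<Rightarrow> real ^ 'n2 ^ 'm2) \<Rightarrow> ('s \<Rightarrow> real ^ 'm2) \<Rightarrow> nat \<Rightarrow> (nat \<Rightarrow> 's)
    \<Rightarrow> (real ^ 'n1) \<times> real"
  where
  "SwC_solution A h1 c1 c2 T1 W2 h2 N \<omega> =
     (THE z. SwC_optimal_design A h1 c1 c2 T1 W2 h2 N \<omega> z)"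

definition binomial_tail :: "nat \<Rightarrow> real \<Rightarrow> nat \<Rightarrow> real"
  where
  "binomial_tail N \<epsilon> d = (\<Sum>k<d. real (N choose k) * \<epsilon> ^ k * (1 - \<epsilon>) ^ (N - k))"

end

theory Submission
  imports Defs
begin

text \<open>
  Every sample \<open>\<xi>\<close> defines a convex constraint \<open>gap \<xi> (x, \<gamma>) \<le> 0\<close> on the \<open>d = n\<^sub>1 + 1\<close> design
  variables, and by Helly's theorem the optimum of a sampled program is already the optimum of at most
  \<open>d\<close> of its constraints. Suppose that every sample of size \<open>m \<ge> d\<close> almost surely contains exactly one
  \<open>d\<close>-subset \<open>I\<close> accepted by all remaining sample points. If \<open>V\<close> denotes the probability that a new
  point rejects \<open>d\<close> given ones, then \<open>1 = (m choose d) * E ((1 - V)^(m - d))\<close> for all \<open>m \<ge> d\<close>. These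
  moments determine the law of \<open>V\<close> (a Beta law), and the binomial tail follows for samples of size \<open>N\<close>.

  The program itself may be degenerate, so its support constraints need not be unique, and there may be
  fewer than \<open>d\<close> of them. Each constraint is therefore relaxed by a small random amount and the
  objective is regularised; now the support constraints are almost surely unique, and the relaxation
  variables also serve as labels which fill up the support constraints to \<open>d\<close> constraints. The relaxed
  optima converge to the given one by uniqueness, and the bound passes to the limit because violation
  of a closed constraint is an open condition.
\<close>

section \<open>Moments of the Beta distribution\<close>

text \<open>The sum telescopes under differentiation: each new term cancels what the earlier ones
  leave, and only a boundary term survives. For \<open>0 < d\<close> and \<open>d \<le> N\<close> it
  is the density of the Beta law with parameters \<open>N - d + 1\<close> and \<open>d\<close>,
  whose distribution function is thus the binomial tail.\<close>

lemma has_real_derivative_binomial_tail: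
  "((\<lambda>s. binomial_tail N (1 - s) d) has_real_derivative
     real (N choose d) * (s ^ (N - d) * (real d * (1 - s) ^ (d - 1)))) (at s)"
proof (induction d)
  case 0
  then show ?case by (simp add: binomial_tail_def)
next
  case (Suc d)
  have eq: "(\<lambda>s. binomial_tail N (1 - s) (Suc d)) =
      (\<lambda>s. binomial_tail N (1 - s) d + real (N choose d) * (1 - s) ^ d * s ^ (N - d))"
    by (simp add: binomial_tail_def)
  \<comment> \<open>This identity turns the coefficient of the surviving term into the one for
    \<open>Suc d\<close>. When \<open>N \<le> d\<close> both sides vanish, so the truncated
    subtraction in the exponents is harmless.\<close>
  have absorb: "real (Suc d) * real (N choose Suc d) = real (N - d) * real (N choose d)"
    by (metis binomial_absorb_comp binomial_absorption mult.commute of_nat_mult)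
  have "((\<lambda>s. binomial_tail N (1 - s) d + real (N choose d) * (1 - s) ^ d * s ^ (N - d))
     has_real_derivative
       real (N choose d) * (s ^ (N - d) * (real d * (1 - s) ^ (d - 1))) +
       (real (N choose d) * (real d * (1 - s) ^ (d - 1) * (- 1)) * s ^ (N - d) +
        real (N choose d) * (1 - s) ^ d * (real (N - d) * s ^ (N - d - 1)))) (at s)"
    by (rule derivative_eq_intros Suc.IH refl | simp)+
  also have "real (N choose d) * (s ^ (N - d) * (real d * (1 - s) ^ (d - 1))) +
       (real (N choose d) * (real d * (1 - s) ^ (d - 1) * (- 1)) * s ^ (N - d) +
        real (N choose d) * (1 - s) ^ d * (real (N - d) * s ^ (N - d - 1)))
      = (real (N - d) * real (N choose d)) * ((1 - s) ^ d * s ^ (N - d - 1))"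
    by (simp add: algebra_simps)
  also have "\<dots> = real (N choose Suc d) * (s ^ (N - Suc d) * (real (Suc d) * (1 - s) ^ (Suc d - 1)))"
    unfolding absorb[symmetric] by simp
  finally show ?case unfolding eq .
qed

lemma binomial_tail_one: "d \<le> N \<Longrightarrow> binomial_tail N 1 d = 0"
  by (auto simp: binomial_tail_def intro!: sum.neutral)

lemma binomial_tail_zero: "0 < d \<Longrightarrow> binomial_tail N 0 d = 1"
  by (cases d) (simp_all add: binomial_tail_def sum.lessThan_Suc_shift del: sum.lessThan_Suc)

lemma has_integral_beta_density:
  assumes "d \<le> N" "0 \<le> s"
  shows "((\<lambda>t. real (N choose d) * (t ^ (N - d) * (real d * (1 - t) ^ (d - 1))))
           has_integral binomial_tail N (1 - s) d) {0..s}"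
proof -
  have "((\<lambda>t. real (N choose d) * (t ^ (N - d) * (real d * (1 - t) ^ (d - 1))))
           has_integral binomial_tail N (1 - s) d - binomial_tail N (1 - 0) d) {0..s}"
    using assms(2) has_real_derivative_binomial_tail
    by (intro fundamental_theorem_of_calculus)
      (auto simp flip: has_real_derivative_iff_has_vector_derivative intro: DERIV_subset)
  then show ?thesis using binomial_tail_one[OF assms(1)] by simp
qed

text \<open>The prescribed moments are those of the Beta law with parameters \<open>1\<close> and
  \<open>d\<close>. They fix the expectation of every polynomial in \<open>T\<close> and, by
  Weierstrass approximation on the compact interval, of every continuous function of
  \<open>T\<close>.\<close>

lemma (in prob_space) beta_moments_imp_expectation:
  fixes T :: "'a \<Rightarrow> real" and \<phi> :: "real \<Rightarrow> real"
  assumes T[measurable]: "T \<in> borel_measurable M"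
    and T01: "\<And>x. x \<in> space M \<Longrightarrow> T x \<in> {0..1}"
    and d: "0 < d"
    and moments: "\<And>m. real (m + d choose d) * expectation (\<lambda>x. T x ^ m) = 1"
    and \<phi>: "continuous_on {0..1} \<phi>"
  shows "expectation (\<lambda>x. \<phi> (T x)) = integral {0..1} (\<lambda>t. \<phi> t * (real d * (1 - t) ^ (d - 1)))"
proof -
  define w where "w = (\<lambda>t::real. real d * (1 - t) ^ (d - 1))"
  have contw: "continuous_on A w" for A
    unfolding w_def by (intro continuous_intros)
  have w0: "0 \<le> w t" if "t \<in> {0..1}" for t
    using that by (simp add: w_def)
  have moment: "expectation (\<lambda>x. T x ^ m) = integral {0..1} (\<lambda>t. t ^ m * w t)" for m
  proof -
    \<comment> \<open>With \<open>N = m + d\<close> and \<open>s = 1\<close> the exponent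
      \<open>N - d\<close> becomes \<open>m\<close>, and the total mass is the binomial tail at
      accuracy \<open>0\<close>, which is \<open>1\<close>.\<close>
    have "((\<lambda>t. real (m + d choose d) * (t ^ m * w t)) has_integral 1) {0..1}"
      using has_integral_beta_density[of d "m + d" 1] binomial_tail_zero[OF d]
      by (simp add: w_def)
    then have "integral {0..1} (\<lambda>t. real (m + d choose d) * (t ^ m * w t)) = 1"
      by (rule integral_unique)
    then have "real (m + d choose d) * integral {0..1} (\<lambda>t. t ^ m * w t) = 1"
      by simp
    with moments[of m] have "real (m + d choose d) * expectation (\<lambda>x. T x ^ m)
        = real (m + d choose d) * integral {0..1} (\<lambda>t. t ^ m * w t)" by simp
    then show ?thesis by simp
  qed
  have intw: "integral {0..1} w = 1"
    using moment[of 0] prob_space by simp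
  have int_T: "integrable M (\<lambda>x. \<psi> (T x))"
    if cont: "continuous_on {0..1} \<psi>" for \<psi> :: "real \<Rightarrow> real"
  proof -
    obtain B where B: "\<forall>y\<in>\<psi> ` {0..1}. norm y \<le> B"
      using compact_imp_bounded[OF compact_continuous_image[OF cont compact_Icc]]
      unfolding bounded_iff by blast
    have "(\<lambda>t. indicator {0..1} t *\<^sub>R \<psi> t) \<in> borel_measurable borel"
      using cont by (intro borel_measurable_continuous_on_indicator) auto
    then have "(\<lambda>x. indicator {0..1} (T x) *\<^sub>R \<psi> (T x)) \<in> borel_measurable M"
      by (rule measurable_compose[OF T])
    also have "?this \<longleftrightarrow> (\<lambda>x. \<psi> (T x)) \<in> borel_measurable M"
      using T01 by (intro measurable_cong) auto
    finally show ?thesis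
      using B T01 by (intro integrable_const_bound[of _ B]) auto
  qed
  \<comment> \<open>One \<open>e\<close> is lost in the expectation and one in the weighted
    integral, since both are taken against probability laws.\<close>
  have le: "\<bar>expectation (\<lambda>x. \<phi> (T x)) - integral {0..1} (\<lambda>t. \<phi> t * w t)\<bar> \<le> 2 * e" if e: "e > 0" for e
  proof -
    obtain p where p: "real_polynomial_function p" "\<And>t. t \<in> {0..1} \<Longrightarrow> \<bar>\<phi> t - p t\<bar> < e"
      using Stone_Weierstrass_real_polynomial_function[OF compact_Icc \<phi> e] by blast
    obtain a n where a: "p = (\<lambda>t. \<Sum>i\<le>n. a i * t ^ i)"
      using p(1) unfolding real_polynomial_function_iff_sum by blast
    have contp: "continuous_on {0..1} p"
      unfolding a by (intro continuous_intros)
    have "expectation (\<lambda>x. p (T x)) = (\<Sum>i\<le>n. a i * expectation (\<lambda>x. T x ^ i))"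
      unfolding a by (subst Bochner_Integration.integral_sum)
        (auto intro!: int_T[of "\<lambda>t. t ^ _"] integrable_mult_right continuous_intros)
    also have "\<dots> = (\<Sum>i\<le>n. integral {0..1} (\<lambda>t. a i * (t ^ i * w t)))"
      by (simp add: moment)
    also have "\<dots> = integral {0..1} (\<lambda>t. \<Sum>i\<le>n. a i * (t ^ i * w t))"
      by (intro integral_sum[symmetric])
        (auto intro!: integrable_continuous_real continuous_intros contw)
    also have "\<dots> = integral {0..1} (\<lambda>t. p t * w t)"
      by (simp add: a sum_distrib_left sum_distrib_right mult_ac)
    finally have pE: "expectation (\<lambda>x. p (T x)) = integral {0..1} (\<lambda>t. p t * w t)" .
    have "\<bar>expectation (\<lambda>x. \<phi> (T x)) - expectation (\<lambda>x. p (T x))\<bar>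
        = \<bar>expectation (\<lambda>x. \<phi> (T x) - p (T x))\<bar>"
      by (simp add: int_T \<phi> contp)
    also have "\<dots> \<le> expectation (\<lambda>x. \<bar>\<phi> (T x) - p (T x)\<bar>)"
      by (rule integral_abs_bound)
    also have "\<dots> \<le> expectation (\<lambda>x. e)"
      using p(2) T01
      by (intro integral_mono) (auto intro!: int_T[of "\<lambda>t. \<bar>\<phi> t - p t\<bar>"] continuous_intros \<phi> contp less_imp_le)
    also have "\<dots> = e" by (simp add: prob_space)
    finally have 1: "\<bar>expectation (\<lambda>x. \<phi> (T x)) - expectation (\<lambda>x. p (T x))\<bar> \<le> e" .
    have "\<bar>integral {0..1} (\<lambda>t. \<phi> t * w t) - integral {0..1} (\<lambda>t. p t * w t)\<bar>
        = norm (integral {0..1} (\<lambda>t. \<phi> t * w t - p t * w t))"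
      by (subst integral_diff) (auto intro!: integrable_continuous_real continuous_intros contw contp \<phi>)
    also have "\<dots> \<le> integral {0..1} (\<lambda>t. e * w t)"
    proof (rule integral_norm_bound_integral)
      fix t :: real assume t: "t \<in> {0..1}"
      have "\<bar>\<phi> t - p t\<bar> * w t \<le> e * w t"
        using p(2)[OF t] w0[OF t] by (intro mult_right_mono) auto
      then show "norm (\<phi> t * w t - p t * w t) \<le> e * w t"
        using w0[OF t] by (simp add: abs_mult flip: left_diff_distrib)
    qed (auto intro!: integrable_continuous_real continuous_intros contw contp \<phi>)
    also have "\<dots> = e" by (simp add: intw)
    finally show ?thesis using 1 pE by linarith
  qed
  have "\<bar>expectation (\<lambda>x. \<phi> (T x)) - integral {0..1} (\<lambda>t. \<phi> t * w t)\<bar> \<le> 0"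
  proof (rule field_le_epsilon)
    fix e :: real assume "0 < e"
    then show "\<bar>expectation (\<lambda>x. \<phi> (T x)) - integral {0..1} (\<lambda>t. \<phi> t * w t)\<bar> \<le> 0 + e"
      using le[of "e / 2"] by simp
  qed
  then show ?thesis by (simp add: w_def)
qed

text \<open>Against the Beta law of \<open>T\<close>, the weight
  \<open>real (N choose d) * t ^ (N - d)\<close> produces the density whose distribution function is
  the binomial tail. The moment result concerns continuous functions, so the indicator is first
  majorised by a continuous ramp.\<close>

lemma (in prob_space) beta_moments_imp_tail_le:
  fixes T :: "'a \<Rightarrow> real"
  assumes T[measurable]: "T \<in> borel_measurable M"
    and T01: "\<And>x. x \<in> space M \<Longrightarrow> T x \<in> {0..1}"
    and d: "0 < d" and N: "d \<le> N"
    and moments: "\<And>m. real (m + d choose d) * expectation (\<lambda>x. T x ^ m) = 1"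
    and s: "0 \<le> s" "s < 1"
  shows "real (N choose d) * expectation (\<lambda>x. indicator {..<s} (T x) * T x ^ (N - d))
          \<le> binomial_tail N (1 - s) d"
proof -
  let ?E = "real (N choose d) * expectation (\<lambda>x. indicator {..<s} (T x) * T x ^ (N - d))"
  have le: "?E \<le> binomial_tail N (1 - s') d" if s': "s < s'" "s' \<le> 1" for s'
  proof -
    \<comment> \<open>The ramp is \<open>1\<close> up to \<open>s\<close>, falls linearly, and is
      \<open>0\<close> from \<open>s'\<close> on; in the end \<open>s'\<close> decreases to
      \<open>s\<close>.\<close>
    define \<phi> where "\<phi> = (\<lambda>t::real. max 0 (min 1 ((s' - t) / (s' - s))))"
    define \<psi> where "\<psi> = (\<lambda>t. real (N choose d) * (\<phi> t * t ^ (N - d)))"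
    have cont\<phi>: "continuous_on A \<phi>" for A
      unfolding \<phi>_def using s' by (intro continuous_intros) auto
    have cont\<psi>: "continuous_on A \<psi>" for A
      unfolding \<psi>_def using cont\<phi> by (intro continuous_intros)
    have ind: "indicator {..<s} t \<le> \<phi> t" for t
      using s' by (auto simp: \<phi>_def indicator_def)
    have \<phi>01: "0 \<le> \<phi> t" "\<phi> t \<le> 1" for t by (auto simp: \<phi>_def)
    have [measurable]: "\<phi> \<in> borel_measurable borel"
      using cont\<phi> by (rule borel_measurable_continuous_onI)
    have Tpow: "0 \<le> T x ^ m" "T x ^ m \<le> 1" if "x \<in> space M" for x m
      using T01[OF that] by (auto intro: power_le_one)
    have "?E = expectation (\<lambda>x. real (N choose d) * (indicator {..<s} (T x) * T x ^ (N - d)))"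
      by simp
    also have "\<dots> \<le> expectation (\<lambda>x. \<psi> (T x))"
      unfolding \<psi>_def
    proof (rule integral_mono)
      show "integrable M (\<lambda>x. real (N choose d) * (indicator {..<s} (T x) * T x ^ (N - d)))"
        using Tpow by (intro integrable_mult_right integrable_const_bound[of _ 1])
          (auto simp: abs_mult indicator_def intro!: mult_le_one)
      show "integrable M (\<lambda>x. real (N choose d) * (\<phi> (T x) * T x ^ (N - d)))"
        using Tpow \<phi>01 by (intro integrable_mult_right integrable_const_bound[of _ 1])
          (auto simp: abs_mult intro!: mult_le_one)
    qed (use ind Tpow in \<open>auto intro!: mult_left_mono mult_right_mono\<close>)
    also have "\<dots> = integral {0..1} (\<lambda>t. \<psi> t * (real d * (1 - t) ^ (d - 1)))"
      using assms cont\<psi> by (intro beta_moments_imp_expectation) auto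
    also have "\<dots> = integral {0..s'} (\<lambda>t. \<psi> t * (real d * (1 - t) ^ (d - 1)))"
    proof (rule integral_spike_set)
      have "{t \<in> {0..1} - {0..s'}. \<psi> t * (real d * (1 - t) ^ (d - 1)) \<noteq> 0} = {}"
        using s s' by (auto simp: \<psi>_def \<phi>_def divide_simps)
      then show "negligible {t \<in> {0..1} - {0..s'}. \<psi> t * (real d * (1 - t) ^ (d - 1)) \<noteq> 0}"
        by (metis negligible_empty)
      have "{t \<in> {0..s'} - {0..1}. \<psi> t * (real d * (1 - t) ^ (d - 1)) \<noteq> 0} = {}"
        using s' by auto
      then show "negligible {t \<in> {0..s'} - {0..1}. \<psi> t * (real d * (1 - t) ^ (d - 1)) \<noteq> 0}"
        by (metis negligible_empty)
    qed
    also have "\<dots> \<le> integral {0..s'} (\<lambda>t. real (N choose d) * (t ^ (N - d) * (real d * (1 - t) ^ (d - 1))))"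
    proof (rule integral_le)
      fix t assume t: "t \<in> {0..s'}"
      have "\<phi> t * (real (N choose d) * (t ^ (N - d) * (real d * (1 - t) ^ (d - 1))))
          \<le> 1 * (real (N choose d) * (t ^ (N - d) * (real d * (1 - t) ^ (d - 1))))"
        using t s' \<phi>01 by (intro mult_right_mono) auto
      then show "\<psi> t * (real d * (1 - t) ^ (d - 1)) \<le>
          real (N choose d) * (t ^ (N - d) * (real d * (1 - t) ^ (d - 1)))"
        by (simp add: \<psi>_def algebra_simps)
    qed (auto intro!: integrable_continuous_real continuous_intros cont\<psi>)
    also have "\<dots> = binomial_tail N (1 - s') d"
      using s s' by (intro integral_unique has_integral_beta_density N) auto
    finally show ?thesis .
  qed
  have "((\<lambda>s'. binomial_tail N (1 - s') d) \<longlongrightarrow> binomial_tail N (1 - s) d) (at s)"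
    using DERIV_isCont[OF has_real_derivative_binomial_tail] by (simp add: isCont_def)
  then have "((\<lambda>s'. binomial_tail N (1 - s') d) \<longlongrightarrow> binomial_tail N (1 - s) d) (at_right s)"
    by (rule filterlim_mono) (auto simp: at_within_le_at)
  moreover have "\<forall>\<^sub>F s' in at_right s. ?E \<le> binomial_tail N (1 - s') d"
    using le s by (intro eventually_at_rightI[of _ 1]) auto
  ultimately show ?thesis
    by (rule tendsto_lowerbound) simp
qed

section \<open>Compression of samples\<close>

text \<open>For \<open>A\<close> outside \<open>sets M\<close> the left side is \<open>0\<close> by
  convention, which lets \<open>risk_tail\<close> speak of arbitrary events
  \<open>G\<close>.\<close>

lemma emeasure_le_nn_integral:
  assumes "AE x in M. x \<in> A \<longrightarrow> 1 \<le> f x"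
  shows "emeasure M A \<le> (\<integral>\<^sup>+x. f x \<partial>M)"
proof (cases "A \<in> sets M")
  case True
  then have "emeasure M A = (\<integral>\<^sup>+x. indicator A x \<partial>M)" by simp
  also have "\<dots> \<le> (\<integral>\<^sup>+x. f x \<partial>M)"
    using assms by (intro nn_integral_mono_AE) (auto simp: indicator_def elim!: eventually_mono)
  finally show ?thesis .
qed (simp add: emeasure_notin_sets)

text \<open>\<open>ok \<tau> q\<close> means that the \<open>d\<close> points \<open>\<tau>\<close>
  accept the further point \<open>q\<close>. The enumerations \<open>enum I\<close> put every choice
  of \<open>d\<close> sample points into the one product space over \<open>{..<d}\<close>.\<close>

locale compression = prob_space M for M :: "'s measure" +
  fixes d :: nat and ok :: "(nat \<Rightarrow> 's) \<Rightarrow> 's \<Rightarrow> bool" and enum :: "nat set \<Rightarrow> nat \<Rightarrow> nat"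
  assumes d_pos: "0 < d"
    and enum: "\<And>I. finite I \<Longrightarrow> card I = d \<Longrightarrow> bij_betw (enum I) {..<d} I"
    and ok_measurable [measurable]:
      "Measurable.pred (PiM {..<d} (\<lambda>_. M) \<Otimes>\<^sub>M M) (\<lambda>(\<tau>, q). ok \<tau> q)"
begin

definition sub :: "nat set \<Rightarrow> (nat \<Rightarrow> 's) \<Rightarrow> nat \<Rightarrow> 's" where
  "sub I \<omega> = (\<lambda>k\<in>{..<d}. \<omega> (enum I k))"

definition compresses :: "nat set \<Rightarrow> (nat \<Rightarrow> 's) \<Rightarrow> nat set \<Rightarrow> bool" where
  "compresses S \<omega> I \<longleftrightarrow> I \<subseteq> S \<and> card I = d \<and> (\<forall>j\<in>S - I. ok (sub I \<omega>) (\<omega> j))"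

definition risk :: "(nat \<Rightarrow> 's) \<Rightarrow> real" where
  "risk \<tau> = prob {q \<in> space M. \<not> ok \<tau> q}"

lemma pred_ok [measurable (raw)]:
  assumes "f \<in> measurable N (PiM {..<d} (\<lambda>_. M))" "g \<in> measurable N M"
  shows "Measurable.pred N (\<lambda>x. ok (f x) (g x))"
  using measurable_compose[OF measurable_Pair[OF assms] ok_measurable] by simp

lemma nn_integral_ok:
  assumes [measurable]: "\<tau> \<in> space (PiM {..<d} (\<lambda>_. M))"
  shows "(\<integral>\<^sup>+q. (if ok \<tau> q then 1 else 0) \<partial>M) = ennreal (1 - risk \<tau>)"
proof -
  have [measurable]: "{q \<in> space M. ok \<tau> q} \<in> sets M"
    by measurable
  have "(\<integral>\<^sup>+q. (if ok \<tau> q then 1 else 0) \<partial>M) = (\<integral>\<^sup>+q. indicator {q \<in> space M. ok \<tau> q} q \<partial>M)"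
    by (intro nn_integral_cong) (auto simp: indicator_def)
  also have "\<dots> = emeasure M {q \<in> space M. ok \<tau> q}" by simp
  also have "\<dots> = ennreal (1 - risk \<tau>)"
    unfolding risk_def emeasure_eq_measure by (subst prob_neg) auto
  finally show ?thesis .
qed

lemma risk_measurable [measurable]: "risk \<in> borel_measurable (PiM {..<d} (\<lambda>_. M))"
proof -
  have "(\<lambda>\<tau>. 1 - enn2real (\<integral>\<^sup>+q. (if ok \<tau> q then 1 else 0) \<partial>M)) \<in> borel_measurable (PiM {..<d} (\<lambda>_. M))"
    by measurable
  also have "?this \<longleftrightarrow> ?thesis"
    by (intro measurable_cong) (simp add: nn_integral_ok risk_def)
  finally show ?thesis .
qed

lemma risk_01: "risk \<tau> \<in> {0..1}"
  by (simp add: risk_def)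

lemma sub_measurable [measurable]:
  assumes "finite S" "I \<subseteq> S" "card I = d"
  shows "sub I \<in> measurable (PiM S (\<lambda>_. M)) (PiM {..<d} (\<lambda>_. M))"
proof -
  have "enum I k \<in> S" if "k < d" for k
    using bij_betwE[OF enum[OF finite_subset[OF assms(2,1)] assms(3)]] assms(2) that by auto
  then show ?thesis
    unfolding sub_def by (intro measurable_restrict) auto
qed

text \<open>Fubini: given the points indexed by \<open>I\<close>, the other points are independent
  and each is accepted with probability \<open>1 - risk\<close>. The factor \<open>\<Phi>\<close>
  allows a restriction to sub-samples of large risk.\<close>

lemma nn_integral_compress:
  assumes S: "finite S" and I: "I \<subseteq> S" "card I = d"
    and \<Phi>[measurable]: "\<Phi> \<in> borel_measurable (PiM {..<d} (\<lambda>_. M))"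
  shows "(\<integral>\<^sup>+\<omega>. \<Phi> (sub I \<omega>) * (\<Prod>j\<in>S - I. if ok (sub I \<omega>) (\<omega> j) then 1 else 0) \<partial>PiM S (\<lambda>_. M))
       = (\<integral>\<^sup>+\<tau>. \<Phi> \<tau> * ennreal ((1 - risk \<tau>) ^ (card S - d)) \<partial>PiM {..<d} (\<lambda>_. M))"
proof -
  interpret product_sigma_finite "\<lambda>_. M" by standard
  have finI: "finite I" using S I finite_subset by blast
  note bij = enum[OF finI I(2)]
  have mem: "enum I k \<in> I" if "k < d" for k
    using bij_betwE[OF bij] that by auto
  note subS[measurable] = sub_measurable[OF S I]
  note subI[measurable] = sub_measurable[OF finI subset_refl I(2)]
  have SI: "I \<union> (S - I) = S" using I by auto
  have "(\<integral>\<^sup>+\<omega>. \<Phi> (sub I \<omega>) * (\<Prod>j\<in>S - I. if ok (sub I \<omega>) (\<omega> j) then 1 else 0) \<partial>PiM S (\<lambda>_. M))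
     = (\<integral>\<^sup>+x. \<integral>\<^sup>+y. \<Phi> (sub I (merge I (S - I) (x, y))) *
          (\<Prod>j\<in>S - I. if ok (sub I (merge I (S - I) (x, y))) (merge I (S - I) (x, y) j) then 1 else 0)
         \<partial>PiM (S - I) (\<lambda>_. M) \<partial>PiM I (\<lambda>_. M))"
    using S finI by (intro product_nn_integral_fold[of I "S - I", unfolded SI]) auto
  also have "\<dots> = (\<integral>\<^sup>+x. \<Phi> (sub I x) * ennreal ((1 - risk (sub I x)) ^ (card S - d)) \<partial>PiM I (\<lambda>_. M))"
  proof (intro nn_integral_cong)
    fix x assume x: "x \<in> space (PiM I (\<lambda>_. M))"
    have sx: "sub I x \<in> space (PiM {..<d} (\<lambda>_. M))"
      using measurable_space[OF subI x] .
    have sub: "sub I (merge I (S - I) (x, y)) = sub I x" for y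
      using mem by (auto simp: sub_def merge_def)
    have mj: "merge I (S - I) (x, y) j = y j" if "j \<in> S - I" for y j
      using that by (simp add: merge_def)
    have "(\<integral>\<^sup>+y. \<Phi> (sub I (merge I (S - I) (x, y))) *
          (\<Prod>j\<in>S - I. if ok (sub I (merge I (S - I) (x, y))) (merge I (S - I) (x, y) j) then 1 else 0)
         \<partial>PiM (S - I) (\<lambda>_. M))
       = (\<integral>\<^sup>+y. \<Phi> (sub I x) * (\<Prod>j\<in>S - I. if ok (sub I x) (y j) then 1 else 0) \<partial>PiM (S - I) (\<lambda>_. M))"
      by (intro nn_integral_cong arg_cong2[of _ _ _ _ "(*)"] prod.cong) (simp_all add: sub mj)
    also have "\<dots> = \<Phi> (sub I x) * (\<integral>\<^sup>+y. (\<Prod>j\<in>S - I. if ok (sub I x) (y j) then 1 else 0) \<partial>PiM (S - I) (\<lambda>_. M))"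
      using sx by (intro nn_integral_cmult) measurable
    also have "(\<integral>\<^sup>+y. (\<Prod>j\<in>S - I. if ok (sub I x) (y j) then 1 else 0) \<partial>PiM (S - I) (\<lambda>_. M))
        = (\<Prod>j\<in>S - I. \<integral>\<^sup>+q. (if ok (sub I x) q then 1 else 0) \<partial>M)"
      using sx S by (intro product_nn_integral_prod) (auto intro: measurable_If)
    also have "\<dots> = ennreal ((1 - risk (sub I x)) ^ (card S - d))"
      using risk_01[of "sub I x"] finI I by (simp add: nn_integral_ok[OF sx] card_Diff_subset ennreal_power)
    finally show "(\<integral>\<^sup>+y. \<Phi> (sub I (merge I (S - I) (x, y))) *
          (\<Prod>j\<in>S - I. if ok (sub I (merge I (S - I) (x, y))) (merge I (S - I) (x, y) j) then 1 else 0)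
         \<partial>PiM (S - I) (\<lambda>_. M)) = \<Phi> (sub I x) * ennreal ((1 - risk (sub I x)) ^ (card S - d))" .
  qed
  also have "\<dots> = (\<integral>\<^sup>+\<tau>. \<Phi> \<tau> * ennreal ((1 - risk \<tau>) ^ (card S - d))
      \<partial>distr (PiM I (\<lambda>_. M)) (PiM {..<d} (\<lambda>_. M)) (sub I))"
    by (subst nn_integral_distr) auto
  \<comment> \<open>Independent points with a common law keep their joint law under the bijective
    renumbering \<open>enum I\<close>, so the integral is the same for all \<open>I\<close>.\<close>
  also have "distr (PiM I (\<lambda>_. M)) (PiM {..<d} (\<lambda>_. M)) (sub I) = PiM {..<d} (\<lambda>_. M)"
    unfolding sub_def using bij mem
    by (intro distr_PiM_reindex[where K = I and I = "{..<d}" and M = "\<lambda>_. M"])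
      (auto simp: bij_betw_def prob_space_axioms)
  finally show ?thesis .
qed

text \<open>Each product is the indicator of \<open>compresses S \<omega> I\<close>, so the expected
  number of compressing sets becomes a sum of the integrals above.\<close>

lemma sum_compresses:
  assumes "finite S"
  shows "(\<Sum>I | I \<subseteq> S \<and> card I = d. \<Prod>j\<in>S - I. if ok (sub I \<omega>) (\<omega> j) then 1 else 0)
     = (of_nat (card {I. compresses S \<omega> I}) :: ennreal)"
proof -
  have "(\<Sum>I | I \<subseteq> S \<and> card I = d. \<Prod>j\<in>S - I. if ok (sub I \<omega>) (\<omega> j) then 1 else (0::ennreal))
    = (\<Sum>I | I \<subseteq> S \<and> card I = d. if compresses S \<omega> I then 1 else 0)"
    using assms by (intro sum.cong) (auto simp: compresses_def prod_zero_iff)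
  also have "\<dots> = of_nat (card {I. compresses S \<omega> I})"
    using assms by (subst sum.If_cases) (auto simp: compresses_def intro!: arg_cong[of _ _ card])
  finally show ?thesis .
qed

text \<open>Uniqueness in samples of every size gives all moments of \<open>1 - risk\<close>, hence
  its law. On \<open>G\<close> the number of compressing sets, weighted by the indicator of large
  risk, is at least \<open>1\<close>; its integral is evaluated with that law.\<close>

theorem risk_tail:
  assumes unique: "\<And>S. finite S \<Longrightarrow> d \<le> card S \<Longrightarrow>
      AE \<omega> in PiM S (\<lambda>_. M). \<exists>!I. compresses S \<omega> I"
    and S: "finite S" "d \<le> card S"
    and \<epsilon>: "0 < \<epsilon>" "\<epsilon> < 1"
    and G: "AE \<omega> in PiM S (\<lambda>_. M). \<omega> \<in> G \<longrightarrow> (\<exists>I. compresses S \<omega> I \<and> \<epsilon> < risk (sub I \<omega>))"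
  shows "measure (PiM S (\<lambda>_. M)) G \<le> binomial_tail (card S) \<epsilon> d"
proof -
  let ?D = "PiM {..<d} (\<lambda>_. M)"
  interpret D: prob_space ?D
    by (intro prob_space_PiM prob_space_axioms)
  have le1: "\<bar>(1 - risk \<tau>) ^ m\<bar> \<le> 1" for \<tau> m
    using risk_01[of \<tau>] by (auto simp: power_abs intro!: power_le_one)
  have moments: "real (m + d choose d) * D.expectation (\<lambda>\<tau>. (1 - risk \<tau>) ^ m) = 1" for m
  proof -
    let ?S = "{..<m + d}"
    interpret P: prob_space "PiM ?S (\<lambda>_. M)"
      by (intro prob_space_PiM prob_space_axioms)
    \<comment> \<open>The expected number of compressing sets in a sample of size
      \<open>m + d\<close> is \<open>1\<close>, and each of the \<open>m + d choose d\<close>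
      candidates contributes the same moment.\<close>
    have "1 = (\<integral>\<^sup>+\<omega>. 1 \<partial>PiM ?S (\<lambda>_. M))"
      using P.emeasure_space_1 by simp
    also have "\<dots> = (\<integral>\<^sup>+\<omega>. of_nat (card {I. compresses ?S \<omega> I}) \<partial>PiM ?S (\<lambda>_. M))"
    proof (rule nn_integral_cong_AE)
      have "AE \<omega> in PiM ?S (\<lambda>_. M). \<exists>!I. compresses ?S \<omega> I"
        by (rule unique) auto
      then show "AE \<omega> in PiM ?S (\<lambda>_. M). 1 = of_nat (card {I. compresses ?S \<omega> I})"
      proof eventually_elim
        case (elim \<omega>)
        then obtain I where "{I. compresses ?S \<omega> I} = {I}" by blast
        then show ?case by simp
      qed
    qed
    also have "\<dots> = (\<integral>\<^sup>+\<omega>. (\<Sum>I | I \<subseteq> ?S \<and> card I = d. 1 * (\<Prod>j\<in>?S - I. if ok (sub I \<omega>) (\<omega> j) then 1 else 0))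
        \<partial>PiM ?S (\<lambda>_. M))"
      by (subst sum_compresses[symmetric]) auto
    also have "\<dots> = (\<Sum>I | I \<subseteq> ?S \<and> card I = d. \<integral>\<^sup>+\<omega>. 1 * (\<Prod>j\<in>?S - I. if ok (sub I \<omega>) (\<omega> j) then 1 else 0)
        \<partial>PiM ?S (\<lambda>_. M))"
      using sub_measurable by (intro nn_integral_sum) (auto intro!: borel_measurable_times_ennreal borel_measurable_prod_ennreal measurable_If)
    also have "\<dots> = (\<Sum>I | I \<subseteq> ?S \<and> card I = d. \<integral>\<^sup>+\<tau>. 1 * ennreal ((1 - risk \<tau>) ^ (card ?S - d)) \<partial>?D)"
      by (intro sum.cong refl nn_integral_compress) auto
    also have "\<dots> = of_nat (m + d choose d) * (\<integral>\<^sup>+\<tau>. ennreal ((1 - risk \<tau>) ^ m) \<partial>?D)"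
      using n_subsets[of ?S d] by simp
    also have "(\<integral>\<^sup>+\<tau>. ennreal ((1 - risk \<tau>) ^ m) \<partial>?D) = ennreal (D.expectation (\<lambda>\<tau>. (1 - risk \<tau>) ^ m))"
      using le1 risk_01 by (intro nn_integral_eq_integral D.integrable_const_bound[of _ 1]) auto
    also have "of_nat (m + d choose d) * \<dots> = ennreal (real (m + d choose d) * D.expectation (\<lambda>\<tau>. (1 - risk \<tau>) ^ m))"
      by (simp add: ennreal_mult' ennreal_of_nat_eq_real_of_nat)
    finally show ?thesis
      by (metis ennreal_eq_1)
  qed
  let ?\<Phi> = "\<lambda>\<tau>. indicator {\<epsilon><..} (risk \<tau>) :: real"
  have \<Phi>int: "integrable ?D (\<lambda>\<tau>. indicator {..<1 - \<epsilon>} (1 - risk \<tau>) * (1 - risk \<tau>) ^ m)" for m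
    using le1 by (intro D.integrable_const_bound[of _ 1]) (auto simp: abs_mult indicator_def)
  have "emeasure (PiM S (\<lambda>_. M)) G
     \<le> (\<integral>\<^sup>+\<omega>. (\<Sum>I | I \<subseteq> S \<and> card I = d. ennreal (?\<Phi> (sub I \<omega>)) *
              (\<Prod>j\<in>S - I. if ok (sub I \<omega>) (\<omega> j) then 1 else 0)) \<partial>PiM S (\<lambda>_. M))"
  proof (rule emeasure_le_nn_integral)
    show "AE \<omega> in PiM S (\<lambda>_. M). \<omega> \<in> G \<longrightarrow> 1 \<le> (\<Sum>I | I \<subseteq> S \<and> card I = d.
       ennreal (?\<Phi> (sub I \<omega>)) * (\<Prod>j\<in>S - I. if ok (sub I \<omega>) (\<omega> j) then 1 else 0))"
      using G
    proof (eventually_elim, intro impI)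
      fix \<omega> assume "\<omega> \<in> G \<longrightarrow> (\<exists>I. compresses S \<omega> I \<and> \<epsilon> < risk (sub I \<omega>))" "\<omega> \<in> G"
      then obtain I where I: "compresses S \<omega> I" "\<epsilon> < risk (sub I \<omega>)" by blast
      then have "1 = ennreal (?\<Phi> (sub I \<omega>)) * (\<Prod>j\<in>S - I. if ok (sub I \<omega>) (\<omega> j) then 1 else 0)"
        by (simp add: compresses_def)
      also have "\<dots> \<le> (\<Sum>I | I \<subseteq> S \<and> card I = d.
         ennreal (?\<Phi> (sub I \<omega>)) * (\<Prod>j\<in>S - I. if ok (sub I \<omega>) (\<omega> j) then 1 else 0))"
        using I S by (intro member_le_sum) (auto simp: compresses_def)
      finally show "1 \<le> (\<Sum>I | I \<subseteq> S \<and> card I = d.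
         ennreal (?\<Phi> (sub I \<omega>)) * (\<Prod>j\<in>S - I. if ok (sub I \<omega>) (\<omega> j) then 1 else 0))" .
    qed
  qed
  also have "\<dots> = (\<Sum>I | I \<subseteq> S \<and> card I = d. \<integral>\<^sup>+\<omega>. ennreal (?\<Phi> (sub I \<omega>)) *
              (\<Prod>j\<in>S - I. if ok (sub I \<omega>) (\<omega> j) then 1 else 0) \<partial>PiM S (\<lambda>_. M))"
  proof (rule nn_integral_sum)
    fix I assume "I \<in> {I. I \<subseteq> S \<and> card I = d}"
    then have [measurable]: "sub I \<in> measurable (PiM S (\<lambda>_. M)) (PiM {..<d} (\<lambda>_. M))"
      using S by (intro sub_measurable) auto
    show "(\<lambda>\<omega>. ennreal (?\<Phi> (sub I \<omega>)) * (\<Prod>j\<in>S - I. if ok (sub I \<omega>) (\<omega> j) then 1 else 0))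
       \<in> borel_measurable (PiM S (\<lambda>_. M))"
      by measurable
  qed
  also have "\<dots> = (\<Sum>I | I \<subseteq> S \<and> card I = d. \<integral>\<^sup>+\<tau>. ennreal (?\<Phi> \<tau>) * ennreal ((1 - risk \<tau>) ^ (card S - d)) \<partial>?D)"
    using S by (intro sum.cong refl nn_integral_compress) auto
  also have "\<dots> = of_nat (card S choose d) *
      (\<integral>\<^sup>+\<tau>. ennreal (indicator {..<1 - \<epsilon>} (1 - risk \<tau>) * (1 - risk \<tau>) ^ (card S - d)) \<partial>?D)"
    using n_subsets[OF S(1), of d] risk_01
    by (auto simp: indicator_def intro!: arg_cong2[of _ _ _ _ "(*)"] nn_integral_cong)
  also have "\<dots> = ennreal (real (card S choose d) *
      D.expectation (\<lambda>\<tau>. indicator {..<1 - \<epsilon>} (1 - risk \<tau>) * (1 - risk \<tau>) ^ (card S - d)))"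
    using risk_01 by (subst nn_integral_eq_integral[OF \<Phi>int])
      (auto simp: ennreal_mult' ennreal_of_nat_eq_real_of_nat indicator_def)
  \<comment> \<open>The moment bound is used with \<open>T = 1 - risk\<close> and
    \<open>s = 1 - \<epsilon>\<close>.\<close>
  also have "\<dots> \<le> ennreal (binomial_tail (card S) (1 - (1 - \<epsilon>)) d)"
    using S \<epsilon> d_pos moments risk_01
    by (intro ennreal_leI D.beta_moments_imp_tail_le) auto
  finally have "emeasure (PiM S (\<lambda>_. M)) G \<le> ennreal (binomial_tail (card S) \<epsilon> d)"
    by simp
  moreover have "0 \<le> binomial_tail (card S) \<epsilon> d"
    using \<epsilon> by (auto simp: binomial_tail_def intro!: sum_nonneg)
  ultimately show ?thesis
    by (simp add: measure_def enn2real_leI)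
qed

end

section \<open>Labelled bases of convex constraints\<close>

text \<open>Sets may repeat in the family, so the indices are thinned out until \<open>C\<close> is
  injective with the same image. If few distinct sets remain, \<open>small\<close> already covers
  all of them at once.\<close>

lemma Helly_indexed:
  fixes C :: "'i \<Rightarrow> 'a::euclidean_space set"
  assumes fin: "finite I" and conv: "\<And>i. i \<in> I \<Longrightarrow> convex (C i)"
    and small: "\<And>J. J \<subseteq> I \<Longrightarrow> card J \<le> DIM('a) + 1 \<Longrightarrow> (\<Inter>i\<in>J. C i) \<noteq> {}"
  shows "(\<Inter>i\<in>I. C i) \<noteq> {}"
proof (cases "card (C ` I) \<ge> DIM('a) + 1")
  case True
  show ?thesis
  proof (rule Helly[OF True])
    fix t assume t: "t \<subseteq> C ` I" "card t = DIM('a) + 1"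
    then obtain J where "J \<subseteq> I" "inj_on C J" "t = C ` J"
      by (auto simp: subset_image_inj)
    then show "\<Inter> t \<noteq> {}"
      using small[of J] t(2) by (simp add: card_image)
  qed (use conv in auto)
next
  case False
  obtain J where "J \<subseteq> I" "inj_on C J" "C ` I = C ` J"
    using subset_image_inj[of "C ` I" C I] by auto
  then show ?thesis
    using small[of J] False by (simp add: card_image)
qed

section \<open>Selection of the largest labels\<close>

lemma exists_top_subset:
  fixes u :: "'i \<Rightarrow> 'b::linorder"
  assumes "finite A" "inj_on u A" "k \<le> card A"
  shows "\<exists>R\<subseteq>A. card R = k \<and> (\<forall>i\<in>R. \<forall>j\<in>A - R. u j < u i)"
  using assms(3)
proof (induction k)
  case 0
  then show ?case by (intro exI[of _ "{}"]) auto
next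
  case (Suc k)
  then obtain R where R: "R \<subseteq> A" "card R = k" "\<forall>i\<in>R. \<forall>j\<in>A - R. u j < u i" by auto
  have "A - R \<noteq> {}" using R Suc.prems by auto
  then have "Max (u ` (A - R)) \<in> u ` (A - R)"
    using assms(1) by (intro Max_in) auto
  then obtain m where "m \<in> A - R" "Max (u ` (A - R)) = u m" by auto
  then have m: "m \<in> A - R" "\<forall>j\<in>A - R. u j \<le> u m"
    using assms(1) Max_ge[of "u ` (A - R)"] by auto
  have "u j < u i" if "i \<in> insert m R" "j \<in> A - insert m R" for i j
  proof (cases "i = m")
    case True
    have "u j \<noteq> u m" using assms(2) m(1) that True by (auto dest: inj_onD)
    then show ?thesis using m(2) that True by (auto simp: less_le)
  qed (use R(3) that in auto)
  moreover have "card (insert m R) = Suc k"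
    using R m assms(1) by (auto simp: finite_subset)
  ultimately show ?case using R(1) m(1) by (intro exI[of _ "insert m R"]) auto
qed

text \<open>Two different sets of equal size each have an element outside the other, and each of
  these two elements would have to carry the larger label.\<close>

lemma top_subset_unique:
  fixes u :: "'i \<Rightarrow> 'b::linorder"
  assumes "finite A" "R \<subseteq> A" "R' \<subseteq> A" "card R = card R'"
    and "\<forall>i\<in>R. \<forall>j\<in>A - R. u j < u i" "\<forall>i\<in>R'. \<forall>j\<in>A - R'. u j < u i"
  shows "R = R'"
proof (rule ccontr)
  assume ne: "R \<noteq> R'"
  have "finite R" "finite R'" using assms(1-3) by (auto intro: finite_subset)
  then have "\<not> R \<subseteq> R'" "\<not> R' \<subseteq> R"
    using ne assms(4) by (metis card_subset_eq)+
  then obtain r r' where "r \<in> R - R'" "r' \<in> R' - R" by auto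
  then have "u r' < u r" "u r < u r'" using assms by auto
  then show False by simp
qed

section \<open>Optima and support constraints of finite convex programs\<close>

lemma convex_sublevel:
  assumes "convex_on UNIV f"
  shows "convex {z. f z \<le> 0}"
proof (rule convexI, simp)
  fix x y and v w :: real
  assume "f x \<le> 0" "f y \<le> 0" and vw: "0 \<le> v" "0 \<le> w" "v + w = 1"
  then have "v * f x + w * f y \<le> 0"
    by (simp add: add_nonpos_nonpos mult_nonneg_nonpos)
  moreover have "f (v *\<^sub>R x + w *\<^sub>R y) \<le> v * f x + w * f y"
    using assms vw by (simp add: convex_on_def)
  ultimately show "f (v *\<^sub>R x + w *\<^sub>R y) \<le> 0" by simp
qed

locale convex_constraints =
  fixes X :: "'a::euclidean_space set" and a :: 'a and g :: "'i \<Rightarrow> 'a \<Rightarrow> real" and S :: "'i set"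
  assumes X: "closed X" "convex X" and fin: "finite S"
    and g_convex: "\<And>i. i \<in> S \<Longrightarrow> convex_on UNIV (g i)"
    and g_cont: "\<And>i. i \<in> S \<Longrightarrow> continuous_on UNIV (g i)"
    and nonempty: "X \<inter> {z. \<forall>i\<in>S. g i z \<le> 0} \<noteq> {}"
begin

definition K :: "'i set \<Rightarrow> 'a set" where
  "K T = X \<inter> {z. \<forall>i\<in>T. g i z \<le> 0}"

text \<open>With the distance to \<open>a\<close> as objective, the optimum exists and is unique for
  every subset of the constraints, the empty one included.\<close>

definition opt :: "'i set \<Rightarrow> 'a" where
  "opt T = closest_point (K T) a"

text \<open>The support constraints of scenario optimisation.\<close>

definition ess :: "'i set \<Rightarrow> 'i set" where
  "ess T = {i\<in>T. opt (T - {i}) \<noteq> opt T}"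

lemma K_antimono: "T \<subseteq> T' \<Longrightarrow> K T' \<subseteq> K T"
  by (auto simp: K_def)

lemma K_ne: "T \<subseteq> S \<Longrightarrow> K T \<noteq> {}"
  using nonempty by (auto simp: K_def)

lemma convex_level: "i \<in> S \<Longrightarrow> convex {z. g i z \<le> 0}"
  by (rule convex_sublevel[OF g_convex])

lemma closed_level: "i \<in> S \<Longrightarrow> closed {z. g i z \<le> 0}"
  using g_cont[of i] by (intro closed_Collect_le) (auto intro: continuous_intros)

lemma K_eq: "K T = X \<inter> (\<Inter>i\<in>T. {z. g i z \<le> 0})"
  by (auto simp: K_def)

lemma convex_K: "T \<subseteq> S \<Longrightarrow> convex (K T)"
  unfolding K_eq using X convex_level by (intro convex_Int convex_INT) auto

lemma closed_K: "T \<subseteq> S \<Longrightarrow> closed (K T)"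
  unfolding K_eq using X closed_level by (intro closed_Int closed_INT) auto

lemma opt_in: "T \<subseteq> S \<Longrightarrow> opt T \<in> K T"
  unfolding opt_def by (intro closest_point_in_set closed_K K_ne)

lemma opt_le: "T \<subseteq> S \<Longrightarrow> y \<in> K T \<Longrightarrow> dist a (opt T) \<le> dist a y"
  unfolding opt_def by (intro closest_point_le closed_K)

lemma opt_unique:
  "T \<subseteq> S \<Longrightarrow> z \<in> K T \<Longrightarrow> (\<And>y. y \<in> K T \<Longrightarrow> dist a z \<le> dist a y) \<Longrightarrow> opt T = z"
  unfolding opt_def using closest_point_unique[OF convex_K closed_K] by metis

lemma opt_extend:
  assumes "T \<subseteq> U" "U \<subseteq> S" "opt T \<in> K U"
  shows "opt U = opt T"
  using assms opt_le[of T] K_antimono[OF assms(1)] by (intro opt_unique) auto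

lemma opt_sandwich:
  assumes "T \<subseteq> U" "U \<subseteq> V" "V \<subseteq> S" "opt T = opt V"
  shows "opt U = opt V"
  using opt_extend[OF assms(1)] assms opt_in[of V] K_antimono[OF assms(2)] by auto

text \<open>If dropping \<open>j\<close> moved the optimum, a short step from the old optimum
  towards the new one would still satisfy the slack constraint \<open>j\<close> and be no farther
  from \<open>a\<close>, against uniqueness of the closest point.\<close>

lemma opt_drop_inactive:
  assumes T: "T \<subseteq> S" "j \<in> T" and slack: "g j (opt T) < 0"
  shows "opt (T - {j}) = opt T"
proof (rule ccontr)
  let ?z = "opt T" and ?y = "opt (T - {j})"
  assume ne: "?y \<noteq> ?z"
  have TS: "T - {j} \<subseteq> S" using T by auto
  have jS: "j \<in> S" using T by auto
  \<comment> \<open>The value makes the convexity bound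
    \<open>(1 - t) * g j ?z + t * \<bar>g j ?y\<bar>\<close> equal to \<open>0\<close>; the absolute
    value keeps \<open>t\<close> in the unit interval whatever the sign of
    \<open>g j ?y\<close>.\<close>
  define t where "t = - g j ?z / (- g j ?z + \<bar>g j ?y\<bar>)"
  have t: "0 < t" "t \<le> 1" using slack by (auto simp: t_def field_simps)
  have tg: "t * (- g j ?z + \<bar>g j ?y\<bar>) = - g j ?z"
    using slack by (simp add: t_def)
  define w where "w = (1 - t) *\<^sub>R ?z + t *\<^sub>R ?y"
  have "g j w \<le> (1 - t) * g j ?z + t * g j ?y"
    unfolding w_def using t by (intro convex_onD[OF g_convex[OF jS]]) auto
  also have "\<dots> \<le> (1 - t) * g j ?z + t * \<bar>g j ?y\<bar>"
    using t by (intro add_left_mono mult_left_mono) auto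
  also have "\<dots> = 0" using tg by (simp add: algebra_simps)
  finally have "g j w \<le> 0" .
  moreover have "w \<in> K (T - {j})"
    unfolding w_def using t opt_in[OF TS] opt_in[OF T(1)] K_antimono[of "T - {j}" T]
    by (intro convexD_alt[OF convex_K[OF TS]]) auto
  ultimately have wK: "w \<in> K T" by (auto simp: K_def)
  have yz: "dist a ?y \<le> dist a ?z"
    using opt_in[OF T(1)] K_antimono[of "T - {j}" T] by (intro opt_le[OF TS]) auto
  have "?z \<in> cball a (dist a ?z)" "?y \<in> cball a (dist a ?z)" using yz by auto
  then have "w \<in> cball a (dist a ?z)"
    unfolding w_def using t by (intro convexD_alt[OF convex_cball]) auto
  then have "opt T = w"
    using wK opt_le[OF T(1)] by (intro opt_unique[OF T(1)]) (auto intro: order_trans)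
  moreover have "w - ?z = t *\<^sub>R (?y - ?z)"
    by (simp add: w_def algebra_simps)
  ultimately have "t *\<^sub>R (?y - ?z) = 0" by simp
  with t ne show False by simp
qed

text \<open>Helly's theorem is applied to the constraint sets together with the open ball of points
  strictly closer to \<open>a\<close> than the optimum. Their intersection is empty, so at most
  \<open>DIM('a) + 1\<close> of them already have empty intersection, and the ball must be among
  these.\<close>

lemma opt_small_subset:
  assumes "T \<subseteq> S"
  shows "\<exists>T'\<subseteq>T. card T' \<le> DIM('a) \<and> opt T' = opt T"
proof -
  define z where "z = opt T"
  \<comment> \<open>\<open>None\<close> stands for the ball. Intersecting every member with
    \<open>X\<close> keeps \<open>X\<close> from costing an extra set in the count.\<close>
  define C where "C = (\<lambda>i. case i of None \<Rightarrow> X \<inter> ball a (dist a z) | Some j \<Rightarrow> X \<inter> {y. g j y \<le> 0})"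
  let ?I = "insert None (Some ` T)"
  have zK: "z \<in> K T" unfolding z_def using assms by (rule opt_in)
  have empty: "(\<Inter>i\<in>?I. C i) = {}"
    using opt_le[OF assms] by (force simp: C_def K_def z_def)
  have "convex (C i)" if "i \<in> ?I" for i
    using that assms X convex_level by (cases i) (auto simp: C_def intro!: convex_Int)
  with empty obtain J where J: "J \<subseteq> ?I" "card J \<le> DIM('a) + 1" "(\<Inter>i\<in>J. C i) = {}"
    using Helly_indexed[of ?I C] fin assms finite_subset[of T S] by auto
  have finJ: "finite J" using J(1) fin assms finite_subset by (metis finite_imageI finite_insert)
  have None: "None \<in> J"
  proof (rule ccontr)
    assume "None \<notin> J"
    then have "z \<in> (\<Inter>i\<in>J. C i)"
      using J(1) zK by (auto simp: C_def K_def)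
    with J(3) show False by simp
  qed
  define T' where "T' = Some -` J"
  have J_eq: "J = insert None (Some ` T')"
    using None J(1) by (auto simp: T'_def)
  have T': "T' \<subseteq> T" using J(1) by (auto simp: T'_def)
  have "finite T'" unfolding T'_def using finJ by (intro finite_vimageI) auto
  then have "card J = card T' + 1"
    unfolding J_eq by (subst card_insert_disjoint) (auto simp: card_image)
  then have "card T' \<le> DIM('a)" using J(2) by simp
  moreover have "opt T' = z"
  proof (rule opt_unique)
    show "z \<in> K T'" using zK K_antimono[OF T'] by auto
    fix y assume y: "y \<in> K T'"
    show "dist a z \<le> dist a y"
    proof (rule ccontr)
      assume "\<not> dist a z \<le> dist a y"
      then have "y \<in> (\<Inter>i\<in>J. C i)"
        unfolding J_eq using y by (auto simp: C_def K_def)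
      with J(3) show False by simp
    qed
  qed (use T' assms in auto)
  ultimately show ?thesis using T' by (auto simp: z_def)
qed

text \<open>A support constraint of \<open>T\<close> belongs to every subset of \<open>T\<close>
  with the same optimum, in particular to a small one.\<close>

lemma card_ess_le:
  assumes "T \<subseteq> S"
  shows "card (ess T) \<le> DIM('a)"
proof -
  obtain T' where T': "T' \<subseteq> T" "card T' \<le> DIM('a)" "opt T' = opt T"
    using opt_small_subset[OF assms] by auto
  have "ess T \<subseteq> T'"
  proof
    fix j assume j: "j \<in> ess T"
    show "j \<in> T'"
    proof (rule ccontr)
      assume "j \<notin> T'"
      then have "opt (T - {j}) = opt T"
        using T' assms by (intro opt_sandwich[of T' "T - {j}" T]) auto
      with j show False by (simp add: ess_def)
    qed
  qed
  then show ?thesis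
    using T' card_mono[of T' "ess T"] finite_subset[OF _ fin, of T'] assms by auto
qed

lemma exists_minimal_basis:
  assumes "T \<subseteq> S"
  shows "\<exists>b\<subseteq>T. opt b = opt T \<and> (\<forall>j\<in>b. opt (b - {j}) \<noteq> opt b)"
proof -
  have "finite T" using assms fin finite_subset by blast
  then show ?thesis using assms
  proof (induction T rule: finite_psubset_induct)
    case (psubset T)
    show ?case
    proof (cases "\<forall>j\<in>T. opt (T - {j}) \<noteq> opt T")
      case False
      then obtain j where j: "j \<in> T" "opt (T - {j}) = opt T" by auto
      then have "\<exists>b\<subseteq>T - {j}. opt b = opt (T - {j}) \<and> (\<forall>j\<in>b. opt (b - {j}) \<noteq> opt b)"
        using psubset.prems by (intro psubset.IH) auto
      then show ?thesis using j by (metis Diff_subset subset_trans)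
    qed auto
  qed
qed

end

text \<open>General position, which excludes several minimal bases for one optimum. The injective
  labels \<open>u\<close> rank the constraints that do not affect the optimum.\<close>

locale nondegenerate_constraints = convex_constraints X a g S
  for X :: "'a::euclidean_space set" and a g and S :: "'i set" +
  fixes u :: "'i \<Rightarrow> real"
  assumes nondegenerate: "\<And>T j. T \<subseteq> S \<Longrightarrow> j \<in> S - T \<Longrightarrow> g j (opt T) \<noteq> 0"
    and inj: "inj_on u S"
begin

text \<open>General position enters in the inclusion of \<open>b\<close> in \<open>ess T\<close>: if
  removing \<open>j\<close> from \<open>T\<close> left the optimum unchanged, \<open>j\<close> would
  be strictly slack there and hence removable from \<open>b\<close> as well.\<close>

lemma minimal_basis_eq_ess:
  assumes T: "T \<subseteq> S" and b: "b \<subseteq> T" "opt b = opt T" "\<forall>j\<in>b. opt (b - {j}) \<noteq> opt b"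
  shows "b = ess T"
proof
  show "b \<subseteq> ess T"
  proof
    fix j assume j: "j \<in> b"
    have "opt (T - {j}) \<noteq> opt T"
    proof
      assume eq: "opt (T - {j}) = opt T"
      have "g j (opt (T - {j})) \<noteq> 0"
        using j b T by (intro nondegenerate) auto
      moreover have "g j (opt T) \<le> 0"
        using opt_in[OF T] j b by (auto simp: K_def)
      ultimately have "opt (b - {j}) = opt b"
        using eq b T j by (intro opt_drop_inactive) auto
      with b(3) j show False by auto
    qed
    with j b show "j \<in> ess T" by (auto simp: ess_def)
  qed
  show "ess T \<subseteq> b"
  proof
    fix j assume j: "j \<in> ess T"
    show "j \<in> b"
    proof (rule ccontr)
      assume "j \<notin> b"
      then have "opt (T - {j}) = opt T"
        using b T by (intro opt_sandwich[of b "T - {j}" T]) auto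
      with j show False by (simp add: ess_def)
    qed
  qed
qed

lemma opt_ess:
  assumes "T \<subseteq> S"
  shows "opt (ess T) = opt T"
proof -
  obtain b where b: "b \<subseteq> T" "opt b = opt T" "\<forall>j\<in>b. opt (b - {j}) \<noteq> opt b"
    using exists_minimal_basis[OF assms] by blast
  then show ?thesis using minimal_basis_eq_ess[OF assms b] by simp
qed

text \<open>A minimal basis of \<open>T\<close> is also one of \<open>U\<close>, and in both roles
  it equals the set of support constraints.\<close>

lemma ess_cong:
  assumes "T \<subseteq> U" "U \<subseteq> S" "opt T = opt U"
  shows "ess T = ess U"
proof -
  obtain b where b: "b \<subseteq> T" "opt b = opt T" "\<forall>j\<in>b. opt (b - {j}) \<noteq> opt b"
    using exists_minimal_basis[OF subset_trans[OF assms(1,2)]] by blast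
  then have "b = ess T" "b = ess U"
    using assms minimal_basis_eq_ess[of T b] minimal_basis_eq_ess[of U b] by auto
  then show ?thesis by simp
qed

text \<open>The support constraints of \<open>opt S\<close> may be fewer than \<open>DIM('a)\<close>; the labels \<open>u\<close> select
  which further constraints complete them.\<close>

theorem unique_labelled_basis:
  assumes card: "DIM('a) \<le> card S"
  shows "\<exists>!I. I \<subseteq> S \<and> card I = DIM('a) \<and>
    (\<forall>j\<in>S - I. g j (opt I) \<le> 0 \<and> (\<forall>i\<in>I. opt (I - {i}) = opt I \<longrightarrow> u j < u i))"
    (is "\<exists>!I. ?P I")
proof -
  let ?e = "ess S"
  have e: "?e \<subseteq> S" by (auto simp: ess_def)
  have fine: "finite ?e" using e fin finite_subset by auto
  \<comment> \<open>Every admissible \<open>I\<close> has the optimum of \<open>S\<close>, so it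
    contains \<open>ess S\<close>. Its other members are those whose removal changes nothing, and
    the label condition makes them the top labels of \<open>S - ess S\<close>; this determines
    \<open>I\<close>.\<close>
  have P: "opt I = opt S \<and> ess I = ?e \<and> I = ?e \<union> (I - ?e) \<and>
      I - ?e \<subseteq> S - ?e \<and> card (I - ?e) = DIM('a) - card ?e \<and>
      (\<forall>i\<in>I - ?e. \<forall>j\<in>(S - ?e) - (I - ?e). u j < u i)" if PI: "?P I" for I
  proof -
    have I: "I \<subseteq> S" using PI by auto
    have "opt I \<in> K S"
      using opt_in[OF I] PI by (auto simp: K_def)
    then have opt: "opt S = opt I" using I by (intro opt_extend) auto
    then have ess: "ess I = ?e" using I by (intro ess_cong) auto
    then have "?e \<subseteq> I" by (auto simp: ess_def)
    moreover have "opt (I - {i}) = opt I" if "i \<in> I - ?e" for i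
      using that unfolding ess[symmetric] by (auto simp: ess_def)
    moreover have "u j < u i" if "i \<in> I - ?e" "j \<in> (S - ?e) - (I - ?e)" for i j
      using calculation(2)[OF that(1)] PI that by blast
    ultimately show ?thesis
      using PI opt ess fine by (auto simp: card_Diff_subset)
  qed
  have "\<exists>R\<subseteq>S - ?e. card R = DIM('a) - card ?e \<and> (\<forall>i\<in>R. \<forall>j\<in>(S - ?e) - R. u j < u i)"
    using fin inj card e fine
    by (intro exists_top_subset) (auto simp: card_Diff_subset intro: inj_on_subset)
  then obtain R where R: "R \<subseteq> S - ?e" "card R = DIM('a) - card ?e"
    "\<forall>i\<in>R. \<forall>j\<in>(S - ?e) - R. u j < u i" by auto
  define I where "I = ?e \<union> R"
  have I: "I \<subseteq> S" using R e by (auto simp: I_def)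
  have optI: "opt I = opt S"
    using I opt_ess[of S] by (intro opt_sandwich[of ?e I S]) (auto simp only: I_def Un_upper1)
  have essI: "ess I = ?e" using I optI by (intro ess_cong) auto
  have "card I = DIM('a)"
  proof -
    have "card I = card ?e + card R"
      unfolding I_def using R(1) fine fin by (intro card_Un_disjoint) (auto intro: finite_subset)
    then show ?thesis using R(2) card_ess_le[of S] by simp
  qed
  moreover have "g j (opt I) \<le> 0" if "j \<in> S - I" for j
    using that opt_in[of S] by (auto simp: optI K_def)
  moreover have "u j < u i" if "j \<in> S - I" "i \<in> I" "opt (I - {i}) = opt I" for i j
  proof -
    have "i \<notin> ess I" using that by (auto simp: ess_def)
    then have "i \<in> R" using that essI by (auto simp: I_def)
    then show ?thesis using R(3) that by (auto simp: I_def)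
  qed
  ultimately have PI: "?P I" using I by blast
  have "I' = I" if "?P I'" for I'
  proof -
    have "I' - ?e = I - ?e"
      using P[OF that] P[OF PI] fin
      by (intro top_subset_unique[where A = "S - ?e" and u = u]) auto
    then show ?thesis using P[OF that] P[OF PI] by metis
  qed
  with PI show ?thesis by (rule ex1I)
qed

end

section \<open>Random convex constraints\<close>

text \<open>By Fubini it suffices to vary the coordinate \<open>j\<close> while the others stay
  fixed.\<close>

lemma (in prob_space) AE_PiM_component_update:
  fixes S :: "'i set"
  assumes S: "finite S" "j \<in> S"
    and R[measurable]: "Measurable.pred (PiM S (\<lambda>_. M)) R"
    and AE: "\<And>x. x \<in> space (PiM (S - {j}) (\<lambda>_. M)) \<Longrightarrow> AE y in M. R (x(j := y))"
  shows "AE \<omega> in PiM S (\<lambda>_. M). R \<omega>"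
proof -
  interpret product_sigma_finite "\<lambda>_. M" by standard
  have ins: "insert j (S - {j}) = S" using S by auto
  have "(\<integral>\<^sup>+\<omega>. (if R \<omega> then 0 else 1) \<partial>PiM S (\<lambda>_. M))
      = (\<integral>\<^sup>+x. \<integral>\<^sup>+y. (if R (x(j := y)) then 0 else 1) \<partial>M \<partial>PiM (S - {j}) (\<lambda>_. M))"
    using S by (intro product_nn_integral_insert[of "S - {j}" j, unfolded ins]) auto
  also have "\<dots> = (\<integral>\<^sup>+x. 0 \<partial>PiM (S - {j}) (\<lambda>_. M))"
  proof (intro nn_integral_cong)
    fix x assume "x \<in> space (PiM (S - {j}) (\<lambda>_. M))"
    then have "(\<integral>\<^sup>+y. (if R (x(j := y)) then 0 else 1) \<partial>M) = (\<integral>\<^sup>+y. 0 \<partial>M)"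
      using AE by (intro nn_integral_cong_AE) (auto elim!: eventually_mono)
    then show "(\<integral>\<^sup>+y. (if R (x(j := y)) then 0 else 1) \<partial>M) = 0" by simp
  qed
  finally have "(\<integral>\<^sup>+\<omega>. (if R \<omega> then 0 else 1) \<partial>PiM S (\<lambda>_. M)) = 0" by simp
  then have "AE \<omega> in PiM S (\<lambda>_. M). (if R \<omega> then 0 else 1) = (0::ennreal)"
    by (subst (asm) nn_integral_0_iff_AE) auto
  then show ?thesis by eventually_elim (auto split: if_splits)
qed

text \<open>\<open>AE_slack\<close> and \<open>AE_label\<close> concern one random constraint
  against a fixed point or value; independence lifts them to general position of a whole sample.
  \<open>nonempty\<close> is demanded of every finite sample, so that \<open>sol\<close> is a
  genuine optimum and not just almost surely.\<close>

locale random_constraints = prob_space M for M :: "'s measure" +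
  fixes X :: "'a::euclidean_space set" and a :: 'a and g :: "'s \<Rightarrow> 'a \<Rightarrow> real" and u :: "'s \<Rightarrow> real"
  assumes X: "closed X" "convex X"
    and g_convex: "\<And>q. q \<in> space M \<Longrightarrow> convex_on UNIV (g q)"
    and g_cont: "\<And>q. q \<in> space M \<Longrightarrow> continuous_on UNIV (g q)"
    and g_measurable [measurable]: "(\<lambda>(q, z). g q z) \<in> borel_measurable (M \<Otimes>\<^sub>M borel)"
    and u_measurable [measurable]: "u \<in> borel_measurable M"
    and nonempty: "\<And>(J::nat set) \<omega>. finite J \<Longrightarrow> (\<And>i. i \<in> J \<Longrightarrow> \<omega> i \<in> space M) \<Longrightarrow>
      X \<inter> {z. \<forall>i\<in>J. g (\<omega> i) z \<le> 0} \<noteq> {}"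
    and AE_slack: "\<And>z. AE q in M. g q z \<noteq> 0"
    and AE_label: "\<And>c. AE q in M. u q \<noteq> c"
begin

definition sol :: "nat set \<Rightarrow> (nat \<Rightarrow> 's) \<Rightarrow> 'a" where
  "sol J \<omega> = closest_point (X \<inter> {z. \<forall>i\<in>J. g (\<omega> i) z \<le> 0}) a"

lemma g_measurable' [measurable (raw)]:
  assumes "f \<in> measurable N M" "h \<in> borel_measurable N"
  shows "(\<lambda>x. g (f x) (h x)) \<in> borel_measurable N"
  using measurable_compose[OF measurable_Pair[OF assms] g_measurable] by simp

lemma family:
  fixes J :: "nat set"
  assumes "finite J" "\<And>i. i \<in> J \<Longrightarrow> \<omega> i \<in> space M"
  shows "convex_constraints X (\<lambda>i. g (\<omega> i)) J"
  by standard (use assms X g_convex g_cont nonempty[of J \<omega>] in auto)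

text \<open>The existential over the possibly uncountable \<open>F\<close> is replaced by one over a
  countable dense subset with tolerance \<open>1 / real (Suc n)\<close>; compactness of
  \<open>F\<close> recovers an exact point as \<open>n\<close> grows.\<close>

lemma hit_measurable:
  assumes I: "finite I" "J \<subseteq> I" and F: "compact F"
  shows "Measurable.pred (PiM I (\<lambda>_. M)) (\<lambda>\<omega>. \<exists>z\<in>F. \<forall>i\<in>J. g (\<omega> i) z \<le> 0)"
proof -
  obtain D where D: "countable D" "D \<subseteq> F" "F \<subseteq> closure D"
    by (rule separable)
  have finJ: "finite J" using I finite_subset by auto
  have [measurable]: "(\<lambda>\<omega>. \<omega> i) \<in> measurable (PiM I (\<lambda>_. M)) M" if "i \<in> J" for i
    using I that by (intro measurable_component_singleton) auto
  have eq: "(\<exists>z\<in>F. \<forall>i\<in>J. g (\<omega> i) z \<le> 0) \<longleftrightarrow>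
      (\<forall>n::nat. \<exists>z\<in>D. \<forall>i\<in>J. g (\<omega> i) z < 1 / real (Suc n))" (is "?L \<longleftrightarrow> ?R")
    if \<omega>: "\<omega> \<in> space (PiM I (\<lambda>_. M))" for \<omega>
  proof -
    have cont: "continuous_on UNIV (g (\<omega> i))" if "i \<in> J" for i
      using that I \<omega> by (intro g_cont) (auto simp: space_PiM PiE_iff)
    show ?thesis
    proof
      assume ?L
      then obtain z where z: "z \<in> F" "\<forall>i\<in>J. g (\<omega> i) z \<le> 0" by auto
      show ?R
      proof
        fix n :: nat
        let ?W = "\<Inter>i\<in>J. {z. g (\<omega> i) z < 1 / real (Suc n)}"
        have "open ?W"
          using finJ cont by (intro open_INT ballI open_Collect_less) (auto intro: continuous_intros)
        moreover have "z \<in> ?W \<inter> closure D"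
          using z D by (auto intro: le_less_trans)
        ultimately have "?W \<inter> D \<noteq> {}"
          using open_Int_closure_eq_empty[of ?W D] by blast
        then show "\<exists>z\<in>D. \<forall>i\<in>J. g (\<omega> i) z < 1 / real (Suc n)" by auto
      qed
    next
      assume R: ?R
      define C where "C = (\<lambda>n::nat. F \<inter> (\<Inter>i\<in>J. {z. g (\<omega> i) z \<le> 1 / real (Suc n)}))"
      have "\<Inter> (range C) \<noteq> {}"
      proof (rule compact_nest)
        show "compact (C n)" for n
          unfolding C_def using F cont
          by (intro compact_Int_closed closed_INT ballI closed_Collect_le) (auto intro: continuous_intros)
        show "C n \<noteq> {}" for n
          using R[rule_format, of n] D(2) by (fastforce simp: C_def)
        show "C n \<subseteq> C m" if "m \<le> n" for m n
        proof -
          have "1 / real (Suc n) \<le> 1 / real (Suc m)" using that by (simp add: frac_le)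
          then show ?thesis by (fastforce simp: C_def)
        qed
      qed
      then obtain z where z: "\<And>n. z \<in> C n" by auto
      have "g (\<omega> i) z \<le> 0" if "i \<in> J" for i
      proof (rule tendsto_lowerbound[OF LIMSEQ_inverse_real_of_nat])
        show "\<forall>\<^sub>F n in sequentially. g (\<omega> i) z \<le> inverse (real (Suc n))"
          using z that by (intro always_eventually) (auto simp: C_def inverse_eq_divide)
      qed simp
      then show ?L using z[of 0] by (auto simp: C_def)
    qed
  qed
  have "Measurable.pred (PiM I (\<lambda>_. M))
      (\<lambda>\<omega>. \<forall>n::nat. \<exists>z\<in>D. \<forall>i\<in>J. g (\<omega> i) z < 1 / real (Suc n))"
    using D(1) finJ by measurable
  then show ?thesis
    using eq by (subst measurable_cong) auto
qed

text \<open>The closest point lies in a closed set \<open>G\<close> exactly when every ball of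
  rational radius around \<open>a\<close> that meets the feasible set also meets its part in
  \<open>G\<close>. For the converse the radius shrinks to the minimal distance, and uniqueness of
  the closest point concludes.\<close>

lemma sol_measurable [measurable]:
  assumes I: "finite I" "J \<subseteq> I"
  shows "sol J \<in> borel_measurable (PiM I (\<lambda>_. M))"
  unfolding borel_eq_closed
proof (rule measurable_measure_of)
  fix G :: "'a set" assume "G \<in> Collect closed"
  then have G: "closed G" by simp
  let ?hit = "\<lambda>F \<omega>. \<exists>z\<in>F. \<forall>i\<in>J. g (\<omega> i) z \<le> 0"
  have eq: "sol J \<omega> \<in> G \<longleftrightarrow> (\<forall>r\<in>\<rat>. ?hit (X \<inter> cball a r) \<omega> \<longrightarrow> ?hit (X \<inter> G \<inter> cball a r) \<omega>)"
    (is "?L \<longleftrightarrow> ?R") if \<omega>: "\<omega> \<in> space (PiM I (\<lambda>_. M))" for \<omega>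
  proof -
    interpret convex_constraints X a "\<lambda>i. g (\<omega> i)" J
      using I \<omega> by (intro family) (auto simp: space_PiM PiE_iff finite_subset)
    have sol: "sol J \<omega> = opt J" by (simp add: sol_def opt_def K_def)
    show ?thesis
    proof
      assume L: ?L
      show ?R
      proof (intro ballI impI)
        fix r assume "?hit (X \<inter> cball a r) \<omega>"
        then obtain y where "y \<in> K J" "dist a y \<le> r" by (auto simp: K_def)
        then have "dist a (opt J) \<le> r" using opt_le[of J y] by simp
        then show "?hit (X \<inter> G \<inter> cball a r) \<omega>"
          using L opt_in[of J] by (auto simp: sol K_def intro!: bexI[of _ "opt J"])
      qed
    next
      assume R: ?R
      let ?r = "dist a (opt J)"
      define C where "C = (\<lambda>n::nat. K J \<inter> G \<inter> cball a (?r + 1 / real (Suc n)))"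
      have "\<Inter> (range C) \<noteq> {}"
      proof (rule compact_nest)
        show "compact (C n)" for n
          unfolding C_def using G closed_K[of J] by (intro closed_Int_compact closed_Int) auto
        show "C n \<noteq> {}" for n
        proof -
          obtain s where s: "s \<in> \<rat>" "?r < s" "s < ?r + 1 / real (Suc n)"
            using Rats_dense_in_real[of ?r "?r + 1 / real (Suc n)"] by auto
          have "?hit (X \<inter> cball a s) \<omega>"
            using s opt_in[of J] by (auto simp: K_def intro!: bexI[of _ "opt J"])
          then have "?hit (X \<inter> G \<inter> cball a s) \<omega>" using R s by blast
          then show ?thesis using s by (auto simp: C_def K_def)
        qed
        show "C n \<subseteq> C m" if "m \<le> n" for m n
        proof -
          have "1 / real (Suc n) \<le> 1 / real (Suc m)" using that by (simp add: frac_le)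
          then show ?thesis by (fastforce simp: C_def)
        qed
      qed
      then obtain y where y: "\<And>n. y \<in> C n" by auto
      have "dist a y - ?r \<le> 0"
      proof (rule tendsto_lowerbound[OF LIMSEQ_inverse_real_of_nat])
        show "\<forall>\<^sub>F n in sequentially. dist a y - ?r \<le> inverse (real (Suc n))"
          using y by (intro always_eventually) (auto simp: C_def inverse_eq_divide algebra_simps)
      qed simp
      moreover have "y \<in> K J" using y by (auto simp: C_def)
      ultimately have "opt J = y"
        using opt_le[of J] by (intro opt_unique) (auto intro: order_trans)
      then show ?L using y[of 0] by (simp add: sol C_def)
    qed
  qed
  have [measurable]: "Measurable.pred (PiM I (\<lambda>_. M)) (?hit (X \<inter> cball a r))"
    "Measurable.pred (PiM I (\<lambda>_. M)) (?hit (X \<inter> G \<inter> cball a r))" for r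
    using I G X by (auto intro!: hit_measurable closed_Int_compact)
  have "Measurable.pred (PiM I (\<lambda>_. M))
      (\<lambda>\<omega>. \<forall>r\<in>\<rat>. ?hit (X \<inter> cball a r) \<omega> \<longrightarrow> ?hit (X \<inter> G \<inter> cball a r) \<omega>)"
    using countable_rat by measurable
  then have "Measurable.pred (PiM I (\<lambda>_. M)) (\<lambda>\<omega>. sol J \<omega> \<in> G)"
    using eq by (subst measurable_cong) auto
  then show "sol J -` G \<inter> space (PiM I (\<lambda>_. M)) \<in> sets (PiM I (\<lambda>_. M))"
    by (simp add: pred_def vimage_def Int_def conj_commute)
qed auto

lemma AE_nondegenerate:
  fixes S :: "nat set"
  assumes S: "finite S"
  shows "AE \<omega> in PiM S (\<lambda>_. M).
    nondegenerate_constraints X a (\<lambda>i. g (\<omega> i)) S (\<lambda>i. u (\<omega> i))"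
proof -
  have slack: "AE \<omega> in PiM S (\<lambda>_. M). g (\<omega> j) (sol T \<omega>) \<noteq> 0" if T: "T \<subseteq> S" "j \<in> S - T" for T :: "nat set" and j
  proof (rule AE_PiM_component_update[OF S])
    show "j \<in> S" using T by auto
    show "Measurable.pred (PiM S (\<lambda>_. M)) (\<lambda>\<omega>. g (\<omega> j) (sol T \<omega>) \<noteq> 0)"
    proof -
      have [measurable]: "(\<lambda>\<omega>. \<omega> j) \<in> measurable (PiM S (\<lambda>_. M)) M"
        using T by (intro measurable_component_singleton) auto
      note [measurable] = sol_measurable[OF S T(1)]
      show ?thesis by measurable
    qed
    fix x :: "nat \<Rightarrow> 's"
    \<comment> \<open>Since \<open>j\<close> lies outside \<open>T\<close>, the optimum does not see
      the new value \<open>y\<close>, and \<open>AE_slack\<close> applies with a fixed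
      point.\<close>
    have "sol T (x(j := y)) = sol T x" for y
      using T by (auto simp: sol_def intro!: arg_cong[of _ _ "\<lambda>A. closest_point A a"])
    then show "AE y in M. g ((x(j := y)) j) (sol T (x(j := y))) \<noteq> 0"
      using AE_slack by simp
  qed
  have label: "AE \<omega> in PiM S (\<lambda>_. M). u (\<omega> j) \<noteq> u (\<omega> i)" if ij: "i \<in> S" "j \<in> S" "i \<noteq> j" for i j
  proof (rule AE_PiM_component_update[OF S ij(2)])
    show "Measurable.pred (PiM S (\<lambda>_. M)) (\<lambda>\<omega>. u (\<omega> j) \<noteq> u (\<omega> i))"
    proof -
      have "(\<lambda>\<omega>. u (\<omega> k)) \<in> borel_measurable (PiM S (\<lambda>_. M))" if "k \<in> S" for k
        using measurable_compose[OF measurable_component_singleton[OF that] u_measurable] .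
      from borel_measurable_neq[OF this[OF ij(2)] this[OF ij(1)]] show ?thesis
        by (simp add: pred_def)
    qed
    show "AE y in M. u ((x(j := y)) j) \<noteq> u ((x(j := y)) i)" for x
      using ij AE_label by simp
  qed
  have "AE \<omega> in PiM S (\<lambda>_. M). \<forall>T\<in>Pow S. \<forall>j\<in>S - T. g (\<omega> j) (sol T \<omega>) \<noteq> 0"
    using S slack by (intro AE_finite_allI) auto
  moreover have "AE \<omega> in PiM S (\<lambda>_. M). \<forall>i\<in>S. \<forall>j\<in>S - {i}. u (\<omega> j) \<noteq> u (\<omega> i)"
    using S label by (intro AE_finite_allI) auto
  ultimately show ?thesis
    using AE_space
  proof eventually_elim
    case (elim \<omega>)
    interpret convex_constraints X a "\<lambda>i. g (\<omega> i)" S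
      using S elim by (intro family) (auto simp: space_PiM PiE_iff)
    have "sol T \<omega> = opt T" for T by (simp add: sol_def opt_def K_def)
    then show ?case
      using elim by unfold_locales (auto simp: inj_on_def)
  qed
qed

theorem violation_tail:
  assumes S: "finite S" "DIM('a) \<le> card S" and \<epsilon>: "0 < \<epsilon>" "\<epsilon> < 1"
  shows "measure (PiM S (\<lambda>_. M)) {\<omega> \<in> space (PiM S (\<lambda>_. M)).
      \<epsilon> < prob {q \<in> space M. 0 < g q (sol S \<omega>)}} \<le> binomial_tail (card S) \<epsilon> (DIM('a))"
proof -
  define d where "d = DIM('a)"
  define enum :: "nat set \<Rightarrow> nat \<Rightarrow> nat" where "enum I = (SOME f. bij_betw f {..<d} I)" for I
  \<comment> \<open>The criterion of \<open>unique_labelled_basis\<close>, phrased through the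
    \<open>d\<close> selected points and the new point alone; \<open>ok_sub\<close> below translates
    it back to sample indices.\<close>
  define ok where "ok \<tau> q \<longleftrightarrow> g q (sol {..<d} \<tau>) \<le> 0 \<and>
    (\<forall>i\<in>{..<d}. sol ({..<d} - {i}) \<tau> = sol {..<d} \<tau> \<longrightarrow> u q < u (\<tau> i))" for \<tau> q
  have enum: "bij_betw (enum I) {..<d} I" if "finite I" "card I = d" for I
  proof -
    have "\<exists>f. bij_betw f {..<d} I"
      using that by (intro finite_same_card_bij) auto
    then show ?thesis unfolding enum_def by (rule someI_ex)
  qed
  have [measurable]: "sol {..<d} \<in> borel_measurable (PiM {..<d} (\<lambda>_. M))"
    "sol ({..<d} - {i}) \<in> borel_measurable (PiM {..<d} (\<lambda>_. M))" for i
    by (auto intro!: sol_measurable)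
  have ok_measurable: "Measurable.pred (PiM {..<d} (\<lambda>_. M) \<Otimes>\<^sub>M M) (\<lambda>(\<tau>, q). ok \<tau> q)"
    unfolding ok_def by measurable
  interpret compression M d ok enum
    by standard (use enum ok_measurable in \<open>auto simp: d_def\<close>)
  have sol_sub: "sol T (sub I \<omega>) = sol (enum I ` T) \<omega>" if "T \<subseteq> {..<d}" for T I \<omega>
    using that by (auto simp: sol_def sub_def intro!: arg_cong[of _ _ "\<lambda>A. closest_point A a"])
  have ok_sub: "ok (sub I \<omega>) q \<longleftrightarrow> g q (sol I \<omega>) \<le> 0 \<and>
      (\<forall>i\<in>I. sol (I - {i}) \<omega> = sol I \<omega> \<longrightarrow> u q < u (\<omega> i))"
    if "finite I" "card I = d" for I \<omega> q
  proof -
    note bij = enum[OF that]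
    then have img: "enum I ` {..<d} = I" by (simp add: bij_betw_def)
    have "enum I ` ({..<d} - {k}) = I - {enum I k}" if "k < d" for k
      using bij that by (auto simp: bij_betw_def inj_on_def)
    then have "ok (sub I \<omega>) q \<longleftrightarrow> g q (sol I \<omega>) \<le> 0 \<and>
      (\<forall>k\<in>{..<d}. sol (I - {enum I k}) \<omega> = sol I \<omega> \<longrightarrow> u q < u (\<omega> (enum I k)))"
      by (auto simp: ok_def sol_sub img) (auto simp: sub_def)
    also have "\<dots> \<longleftrightarrow> g q (sol I \<omega>) \<le> 0 \<and>
      (\<forall>i\<in>enum I ` {..<d}. sol (I - {i}) \<omega> = sol I \<omega> \<longrightarrow> u q < u (\<omega> i))"
      by blast
    finally show ?thesis unfolding img .
  qed
  have unique: "AE \<omega> in PiM S' (\<lambda>_. M). \<exists>!I. compresses S' \<omega> I" if S': "finite S'" "d \<le> card S'" for S'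
    using AE_nondegenerate[OF S'(1)]
  proof eventually_elim
    case (elim \<omega>)
    interpret nondegenerate_constraints X a "\<lambda>i. g (\<omega> i)" S' "\<lambda>i. u (\<omega> i)" by fact
    have sol: "sol T \<omega> = opt T" for T by (simp add: sol_def opt_def K_def)
    have "compresses S' \<omega> I \<longleftrightarrow> I \<subseteq> S' \<and> card I = d \<and>
      (\<forall>j\<in>S' - I. g (\<omega> j) (opt I) \<le> 0 \<and> (\<forall>i\<in>I. opt (I - {i}) = opt I \<longrightarrow> u (\<omega> j) < u (\<omega> i)))" for I
    proof (cases "I \<subseteq> S' \<and> card I = d")
      case True
      then have "finite I" using S'(1) finite_subset by auto
      then show ?thesis using True ok_sub[of I \<omega>] by (simp add: compresses_def sol)
    qed (unfold compresses_def, blast)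
    then show ?case
      using unique_labelled_basis S'(2) by (simp add: d_def)
  qed
  show ?thesis
    unfolding d_def[symmetric]
  proof (rule risk_tail[OF unique])
    show "AE \<omega> in PiM S (\<lambda>_. M). \<omega> \<in> {\<omega> \<in> space (PiM S (\<lambda>_. M)).
      \<epsilon> < prob {q \<in> space M. 0 < g q (sol S \<omega>)}} \<longrightarrow>
      (\<exists>I. compresses S \<omega> I \<and> \<epsilon> < risk (sub I \<omega>))"
      using unique[OF S[folded d_def]] AE_space
    proof (eventually_elim, intro impI)
      fix \<omega>
      assume "\<exists>!I. compresses S \<omega> I" and \<omega>: "\<omega> \<in> space (PiM S (\<lambda>_. M))"
        and viol: "\<omega> \<in> {\<omega> \<in> space (PiM S (\<lambda>_. M)). \<epsilon> < prob {q \<in> space M. 0 < g q (sol S \<omega>)}}"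
      then obtain I where I: "compresses S \<omega> I" by blast
      then have IS: "I \<subseteq> S" "card I = d" "finite I"
        using S finite_subset by (auto simp: compresses_def)
      interpret convex_constraints X a "\<lambda>i. g (\<omega> i)" S
        using S \<omega> by (intro family) (auto simp: space_PiM PiE_iff)
      have sol: "sol T \<omega> = opt T" for T by (simp add: sol_def opt_def K_def)
      \<comment> \<open>The sample points outside \<open>I\<close> accept the optimum for
        \<open>I\<close>, so it is feasible for all of \<open>S\<close> and therefore optimal
        there.\<close>
      have "opt I \<in> K S"
        using opt_in[OF IS(1)] I IS by (auto simp: compresses_def ok_sub sol K_def)
      then have eq: "sol S \<omega> = sol I \<omega>"
        unfolding sol using IS by (intro opt_extend) auto
      have [measurable]: "sub I \<omega> \<in> space (PiM {..<d} (\<lambda>_. M))"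
        using measurable_space[OF sub_measurable[OF S(1) IS(1,2)] \<omega>] .
      \<comment> \<open>Violating the constraint is one way of being rejected; a label that is too
        large is another, so this is only an inequality.\<close>
      have "prob {q \<in> space M. 0 < g q (sol S \<omega>)} \<le> risk (sub I \<omega>)"
        unfolding risk_def
      proof (rule finite_measure_mono)
        show "{q \<in> space M. 0 < g q (sol S \<omega>)} \<subseteq> {q \<in> space M. \<not> ok (sub I \<omega>) q}"
          using IS by (auto simp: ok_sub eq)
        show "{q \<in> space M. \<not> ok (sub I \<omega>) q} \<in> sets M"
          by measurable
      qed
      with viol I show "\<exists>I. compresses S \<omega> I \<and> \<epsilon> < risk (sub I \<omega>)" by auto
    qed
  qed (use S \<epsilon> in \<open>auto simp: d_def\<close>)
qed

end

section \<open>Cones and relaxed minimisers\<close>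

text \<open>Nearly nearest points of \<open>x\<close> and \<open>y\<close> are combined inside
  \<open>A\<close>; the error \<open>e\<close> is there because the infimum need not be
  attained.\<close>

lemma convex_on_infdist:
  fixes A :: "'a::real_normed_vector set"
  assumes A: "convex A" "A \<noteq> {}"
  shows "convex_on UNIV (\<lambda>x. infdist x A)"
proof (rule convex_onI)
  fix t :: real and x y :: 'a
  assume t: "0 < t" "t < 1"
  show "infdist ((1 - t) *\<^sub>R x + t *\<^sub>R y) A \<le> (1 - t) * infdist x A + t * infdist y A"
  proof (rule field_le_epsilon)
    fix e :: real assume e: "0 < e"
    have ex: "\<exists>a\<in>A. dist z a < infdist z A + e" for z
      using cInf_lessD[of "dist z ` A" "infdist z A + e"] A e by (auto simp: infdist_notempty)
    obtain a b where ab: "a \<in> A" "dist x a < infdist x A + e" "b \<in> A" "dist y b < infdist y A + e"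
      using ex[of x] ex[of y] by auto
    have "infdist ((1 - t) *\<^sub>R x + t *\<^sub>R y) A
        \<le> dist ((1 - t) *\<^sub>R x + t *\<^sub>R y) ((1 - t) *\<^sub>R a + t *\<^sub>R b)"
      using ab t A by (intro infdist_le convexD_alt) auto
    also have "\<dots> = norm ((1 - t) *\<^sub>R (x - a) + t *\<^sub>R (y - b))"
      by (simp add: dist_norm algebra_simps)
    also have "\<dots> \<le> (1 - t) * dist x a + t * dist y b"
      using t by (intro norm_triangle_le) (simp add: dist_norm)
    also have "\<dots> \<le> (1 - t) * (infdist x A + e) + t * (infdist y A + e)"
      using ab t by (intro add_mono mult_left_mono) auto
    also have "\<dots> = (1 - t) * infdist x A + t * infdist y A + e"
      by (simp add: algebra_simps)
    finally show "infdist ((1 - t) *\<^sub>R x + t *\<^sub>R y) A \<le> (1 - t) * infdist x A + t * infdist y A + e" .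
  qed
qed simp

section \<open>Finitely generated cones and measurable distances\<close>

lemma nonneg_orthant_eq_cone_hull:
  "{x::'a::euclidean_space. \<forall>b\<in>Basis. 0 \<le> x \<bullet> b} = convex_cone hull Basis" (is "?O = _")
proof
  show "convex_cone hull Basis \<subseteq> ?O"
  proof (rule hull_minimal)
    show "Basis \<subseteq> ?O" by (auto simp: inner_Basis)
    show "convex_cone ?O"
      by (auto simp: convex_cone_iff inner_add_left)
  qed
  show "?O \<subseteq> convex_cone hull Basis"
  proof
    fix x :: 'a assume x: "x \<in> ?O"
    have "(\<Sum>b\<in>B. (x \<bullet> b) *\<^sub>R b) \<in> convex_cone hull Basis" if "finite B" "B \<subseteq> Basis" for B
      using that
    proof (induction B rule: finite_induct)
      case (insert b B)
      then show ?case
        using x by (auto intro!: convex_cone_hull_add convex_cone_hull_mul intro: hull_inc)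
    qed (simp add: convex_cone_hull_contains_0)
    from this[of Basis] show "x \<in> convex_cone hull Basis"
      by (simp add: euclidean_representation)
  qed
qed

text \<open>A linear image of a closed cone may fail to be closed, but the orthant is generated by
  the finite set \<open>Basis\<close>, so its image is again a finitely generated cone.\<close>

lemma closed_linear_image_nonneg_orthant:
  fixes L :: "'a::euclidean_space \<Rightarrow> 'b::euclidean_space"
  assumes "linear L"
  shows "closed (L ` {x. \<forall>b\<in>Basis. 0 \<le> x \<bullet> b})"
  unfolding nonneg_orthant_eq_cone_hull convex_cone_hull_linear_image[OF assms, symmetric]
  by (intro closed_convex_cone_hull) auto

text \<open>By continuity of \<open>L x\<close> the infimum may be taken over a countable dense
  subset of the fixed set \<open>E\<close>.\<close>

lemma infdist_measurable_image:
  fixes L :: "'s \<Rightarrow> 'a::euclidean_space \<Rightarrow> 'b::euclidean_space"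
  assumes E: "E \<noteq> {}"
    and p[measurable]: "p \<in> borel_measurable M"
    and L: "\<And>y. (\<lambda>x. L x y) \<in> borel_measurable M" "\<And>x. x \<in> space M \<Longrightarrow> continuous_on UNIV (L x)"
  shows "(\<lambda>x. infdist (p x) (L x ` E)) \<in> borel_measurable M"
  unfolding borel_measurable_iff_less
proof
  fix r
  obtain D where D: "countable D" "D \<subseteq> E" "E \<subseteq> closure D"
    by (rule separable)
  note [measurable] = L(1)
  have "infdist (p x) (L x ` E) < r \<longleftrightarrow> (\<exists>y\<in>D. dist (p x) (L x y) < r)" if x: "x \<in> space M" for x
  proof -
    have "infdist (p x) (L x ` E) < r \<longleftrightarrow> (\<exists>y\<in>E. dist (p x) (L x y) < r)"
    proof -
      have "bdd_below (dist (p x) ` L x ` E)"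
        by (auto intro!: bdd_belowI[of _ 0])
      then show ?thesis
        using E cInf_less_iff[of "dist (p x) ` L x ` E" r] by (simp add: infdist_notempty)
    qed
    also have "\<dots> \<longleftrightarrow> {y. dist (p x) (L x y) < r} \<inter> E \<noteq> {}" by auto
    also have "\<dots> \<longleftrightarrow> {y. dist (p x) (L x y) < r} \<inter> D \<noteq> {}"
    proof -
      have "open {y. dist (p x) (L x y) < r}"
        using L(2)[OF x] by (intro open_Collect_less continuous_intros)
      then show ?thesis
        using D open_Int_closure_eq_empty[of "{y. dist (p x) (L x y) < r}" D] by blast
    qed
    finally show ?thesis by auto
  qed
  then have "{x \<in> space M. infdist (p x) (L x ` E) < r} = {x \<in> space M. \<exists>y\<in>D. dist (p x) (L x y) < r}"
    by auto
  also have "\<dots> \<in> sets M"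
    using D(1) by measurable
  finally show "{x \<in> space M. infdist (p x) (L x ` E) < r} \<in> sets M" .
qed

lemma measurable_matrix_vector_mult [measurable (raw)]:
  fixes A :: "'s \<Rightarrow> real ^ 'n ^ 'm" and x :: "'s \<Rightarrow> real ^ 'n"
  assumes "A \<in> borel_measurable M" "x \<in> borel_measurable M"
  shows "(\<lambda>w. A w *v x w) \<in> borel_measurable M"
proof (rule borel_measurable_continuous_Pair[OF assms])
  show "continuous_on UNIV (\<lambda>z. fst z *v snd z :: real ^ 'm)"
    unfolding matrix_vector_mult_def by (intro continuous_intros)
qed

text \<open>A bound of Fatou type: \<open>A\<close> is exhausted by the increasing sets
  \<open>C m\<close> of its points that lie in all \<open>B n\<close> with
  \<open>m \<le> n\<close>.\<close>

lemma (in finite_measure) eventually_measure_gt: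
  fixes B :: "nat \<Rightarrow> 'a set"
  assumes A: "A \<in> sets M" and B: "\<And>n. B n \<in> sets M"
    and ev: "\<And>x. x \<in> A \<Longrightarrow> \<forall>\<^sub>F n in sequentially. x \<in> B n"
    and c: "c < measure M A"
  shows "\<forall>\<^sub>F n in sequentially. c < measure M (B n)"
proof -
  define C where "C = (\<lambda>m. A \<inter> (\<Inter>n\<in>{m..}. B n))"
  have C: "C m \<in> sets M" for m
    unfolding C_def using A B by (intro sets.Int sets.countable_INT) auto
  have "incseq C" by (auto simp: C_def incseq_def)
  moreover have "(\<Union>m. C m) = A"
    using ev by (fastforce simp: C_def eventually_sequentially)
  ultimately have "(\<lambda>m. measure M (C m)) \<longlonglongrightarrow> measure M A"
    using C finite_Lim_measure_incseq[of C] by auto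
  then have "\<forall>\<^sub>F m in sequentially. c < measure M (C m)"
    using c by (rule order_tendstoD)
  then show ?thesis
  proof (rule eventually_mono)
    fix m assume "c < measure M (C m)"
    also have "\<dots> \<le> measure M (B m)"
      using B by (intro finite_measure_mono) (auto simp: C_def)
    finally show "c < measure M (B m)" .
  qed
qed

text \<open>A violating sequence, pulled back along segments towards the limit \<open>z\<close>, would lie on a fixed
  sphere around \<open>z\<close>, and its cluster points would contradict uniqueness. The point \<open>(0, - real (Suc n))\<close>
  encodes the regularised objective: minimising the distance to it amounts to minimising
  \<open>snd y + (norm y)\<^sup>2 / (2 * real (Suc n))\<close>.\<close>

lemma relaxed_minimiser_tendsto:
  fixes X :: "('a::euclidean_space \<times> real) set" and G :: "'i \<Rightarrow> 'a \<times> real \<Rightarrow> real"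
  assumes S: "finite S" and X: "closed X" "convex X"
    and G: "\<And>i. i \<in> S \<Longrightarrow> convex_on UNIV (G i)" "\<And>i. i \<in> S \<Longrightarrow> continuous_on UNIV (G i)"
    and v: "\<And>i. 0 \<le> v i"
    and z: "z \<in> X" "\<And>i. i \<in> S \<Longrightarrow> G i z \<le> 0"
    and unique: "\<And>y. y \<in> X \<Longrightarrow> (\<And>i. i \<in> S \<Longrightarrow> G i y \<le> 0) \<Longrightarrow> snd y \<le> snd z \<Longrightarrow> y = z"
  shows "(\<lambda>n. closest_point (X \<inter> {y. \<forall>i\<in>S. G i y - v i / real (Suc n) \<le> 0}) (0, - real (Suc n))) \<longlonglongrightarrow> z"
    (is "?zn \<longlonglongrightarrow> z")
proof (rule tendstoI)
  fix \<eta> :: real assume \<eta>: "0 < \<eta>"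
  define F where "F = (\<lambda>n. X \<inter> {y. \<forall>i\<in>S. G i y - v i / real (Suc n) \<le> 0})"
  \<comment> \<open>The sphere makes these sets compact although the feasible sets may be unbounded.
    They decrease with \<open>n\<close>, so once their intersection is empty, one of them
    is.\<close>
  define C where "C = (\<lambda>n. F n \<inter> {y. snd y \<le> snd z + (norm z)\<^sup>2 / real (Suc n)} \<inter> sphere z \<eta>)"
  have conv: "convex_constraints X (\<lambda>i y. G i y - v i / real (Suc n)) S" for n
  proof
    have "0 \<le> v i / real (Suc n)" for i using v[of i] by simp
    then have "z \<in> X \<inter> {y. \<forall>i\<in>S. G i y - v i / real (Suc n) \<le> 0}"
      using z by (auto intro: order_trans)
    then show "X \<inter> {y. \<forall>i\<in>S. G i y - v i / real (Suc n) \<le> 0} \<noteq> {}" by blast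
    show "convex_on UNIV (\<lambda>y. G i y - v i / real (Suc n))" if "i \<in> S" for i
      using G(1)[OF that] convex_on_add[of UNIV "G i" "\<lambda>_. - (v i / real (Suc n))"]
      by (simp add: convex_on_const)
    show "continuous_on UNIV (\<lambda>y. G i y - v i / real (Suc n))" if "i \<in> S" for i
      using G(2)[OF that] by (intro continuous_intros)
  qed (use X S in auto)
  have step: "1 / real (Suc n) \<le> 1 / real (Suc m)" if "m \<le> n" for m n
    using that by (simp add: frac_le)
  have zF: "z \<in> F n" for n
  proof -
    have "0 \<le> v i / real (Suc n)" for i using v[of i] by simp
    then show ?thesis using z by (auto simp: F_def intro: order_trans)
  qed
  have zn: "?zn n \<in> F n" "dist (0, - real (Suc n)) (?zn n) \<le> dist (0, - real (Suc n)) z"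
    "closed (F n)" "convex (F n)" for n
  proof -
    interpret convex_constraints X "(0, - real (Suc n))" "\<lambda>i y. G i y - v i / real (Suc n)" S
      by (rule conv)
    have KF: "K S = F n" by (simp only: K_def F_def)
    have opt: "opt S = ?zn n" by (simp only: opt_def KF F_def)
    show "?zn n \<in> F n" "dist (0, - real (Suc n)) (?zn n) \<le> dist (0, - real (Suc n)) z"
      using opt_in[of S] opt_le[of S z] zF[of n] unfolding KF opt by auto
    show "closed (F n)" "convex (F n)"
      using closed_K[of S] convex_K[of S] unfolding KF by auto
  qed
  \<comment> \<open>Comparing squared distances to \<open>(0, - k)\<close> and dropping the
    nonnegative squares of the minimiser leaves
    \<open>2 * k * \<gamma> \<le> 2 * k * \<gamma>0 + (norm z)\<^sup>2\<close>; a factor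
    \<open>2\<close> is then given away.\<close>
  have snd_le: "snd (?zn n) \<le> snd z + (norm z)\<^sup>2 / real (Suc n)" for n
  proof -
    define k where "k = real (Suc n)"
    have k: "0 < k" by (simp add: k_def)
    obtain x \<gamma> where zn': "?zn n = (x, \<gamma>)" by (cases "?zn n")
    obtain x0 \<gamma>0 where z': "z = (x0, \<gamma>0)" by (cases z)
    have "dist (0, - k) (x, \<gamma>) \<le> dist (0, - k) (x0, \<gamma>0)"
      using zn(2)[of n] unfolding zn' k_def z' .
    then have "(norm x)\<^sup>2 + (- k - \<gamma>)\<^sup>2 \<le> (norm x0)\<^sup>2 + (- k - \<gamma>0)\<^sup>2"
      by (simp add: dist_norm norm_Pair)
    then have "(norm x)\<^sup>2 + (\<gamma> + k)\<^sup>2 \<le> (norm x0)\<^sup>2 + (\<gamma>0 + k)\<^sup>2"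
      by (simp add: power2_eq_square algebra_simps)
    then have "(norm x)\<^sup>2 + \<gamma>\<^sup>2 + 2 * k * \<gamma> \<le> 2 * k * \<gamma>0 + ((norm x0)\<^sup>2 + \<gamma>0\<^sup>2)"
      by (simp add: power2_sum algebra_simps)
    then have "2 * k * \<gamma> \<le> 2 * k * \<gamma>0 + ((norm x0)\<^sup>2 + \<gamma>0\<^sup>2)"
      using zero_le_power2[of "norm x"] zero_le_power2[of \<gamma>] by linarith
    also have "(norm x0)\<^sup>2 + \<gamma>0\<^sup>2 = (norm z)\<^sup>2"
      by (simp add: z' norm_Pair)
    also have "\<dots> \<le> 2 * (norm z)\<^sup>2" by simp
    finally have "k * \<gamma> \<le> k * \<gamma>0 + (norm z)\<^sup>2" by simp
    then have "\<gamma> \<le> \<gamma>0 + (norm z)\<^sup>2 / k"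
      using k by (simp add: field_simps)
    then show ?thesis unfolding zn' by (simp add: z' k_def)
  qed
  have empty: "\<Inter> (range C) = {}"
  proof (rule ccontr)
    assume "\<Inter> (range C) \<noteq> {}"
    then obtain y where y: "\<And>n. y \<in> C n" by auto
    have lim: "c \<le> (0::real)" if "\<And>n. c \<le> b / real (Suc n)" for b c
    proof (rule tendsto_lowerbound)
      show "(\<lambda>n. b * inverse (real (Suc n))) \<longlonglongrightarrow> 0"
        by (intro tendsto_mult_right_zero LIMSEQ_inverse_real_of_nat)
      show "\<forall>\<^sub>F n in sequentially. c \<le> b * inverse (real (Suc n))"
        using that by (intro always_eventually) (simp add: divide_inverse)
    qed simp
    have "y = z"
    proof (rule unique)
      show "y \<in> X" using y[of 0] by (auto simp: C_def F_def)
      show "G i y \<le> 0" if "i \<in> S" for i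
        using y that by (intro lim[of _ "v i"]) (auto simp: C_def F_def)
      have "snd y - snd z \<le> 0"
        using y by (intro lim[of _ "(norm z)\<^sup>2"]) (auto simp: C_def algebra_simps)
      then show "snd y \<le> snd z" by simp
    qed
    with y[of 0] \<eta> show False by (auto simp: C_def)
  qed
  have compact: "compact (C n)" for n
    unfolding C_def
    by (intro closed_Int_compact closed_Int zn closed_Collect_le continuous_intros) auto
  have mono: "C n \<subseteq> C m" if "m \<le> n" for m n
  proof -
    have "b / real (Suc n) \<le> b / real (Suc m)" if "0 \<le> b" for b
      using mult_left_mono[OF step[OF \<open>m \<le> n\<close>] that] by simp
    note le = this[OF v] this[of "(norm z)\<^sup>2", OF zero_le_power2]
    show ?thesis
    proof
      fix y assume y: "y \<in> C n"
      have "G i y - v i / real (Suc m) \<le> 0" if "i \<in> S" for i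
      proof -
        have "G i y - v i / real (Suc n) \<le> 0" using y that unfolding C_def F_def by blast
        then show ?thesis using le(1)[of i] by linarith
      qed
      moreover have "snd y \<le> snd z + (norm z)\<^sup>2 / real (Suc m)"
      proof -
        have "snd y \<le> snd z + (norm z)\<^sup>2 / real (Suc n)" using y unfolding C_def by blast
        then show ?thesis using le(2) by linarith
      qed
      ultimately show "y \<in> C m" using y unfolding C_def F_def by blast
    qed
  qed
  obtain m where m: "C m = {}"
    using compact_nest[of C] compact mono empty by blast
  have "dist (?zn n) z < \<eta>" if "m \<le> n" for n
  proof (rule ccontr)
    assume far: "\<not> dist (?zn n) z < \<eta>"
    define D where "D = dist (?zn n) z"
    have D: "\<eta> \<le> D" using far unfolding D_def by linarith
    \<comment> \<open>With this ratio the point \<open>y\<close> of the segment has distance exactly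
      \<open>\<eta>\<close> from \<open>z\<close>.\<close>
    define t where "t = \<eta> / D"
    have t: "0 < t" "t \<le> 1" using D \<eta> by (auto simp: t_def field_simps)
    define y where "y = (1 - t) *\<^sub>R z + t *\<^sub>R ?zn n"
    have "y \<in> F n"
      unfolding y_def using t by (intro convexD_alt zn zF) auto
    moreover have "snd y \<le> snd z + (norm z)\<^sup>2 / real (Suc n)"
    proof -
      have "snd y = (1 - t) * snd z + t * snd (?zn n)"
        by (simp add: y_def)
      also have "\<dots> \<le> (1 - t) * (snd z + (norm z)\<^sup>2 / real (Suc n)) + t * (snd z + (norm z)\<^sup>2 / real (Suc n))"
        using t snd_le[of n] by (intro add_mono mult_left_mono) auto
      also have "\<dots> = snd z + (norm z)\<^sup>2 / real (Suc n)"
        by (simp only: distrib_right[symmetric]) simp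
      finally show ?thesis .
    qed
    moreover have "dist z y = \<eta>"
    proof -
      have "y - z = t *\<^sub>R (?zn n - z)" by (simp add: y_def algebra_simps)
      then have "dist y z = t * D" using t unfolding D_def dist_norm by (simp only: norm_scaleR abs_of_pos)
      also have "\<dots> = \<eta>" using D \<eta> by (auto simp: t_def)
      finally show ?thesis by (simp add: dist_commute)
    qed
    ultimately have "y \<in> C n" by (auto simp: C_def)
    with mono[OF that] m show False by auto
  qed
  then show "\<forall>\<^sub>F n in sequentially. dist (?zn n) z < \<eta>"
    unfolding eventually_sequentially by blast
qed

section \<open>The constraint of a sample as a convex function\<close>

text \<open>The coordinate \<open>s\<close> is the slack of the cost inequality; the existence of a
  certificate becomes membership in a linear image of a nonnegative orthant.\<close>

definition certificate_image ::
  "('s \<Rightarrow> real ^ 'n2) \<Rightarrow> ('s \<Rightarrow> real ^ 'n2 ^ 'm2) \<Rightarrow> 's \<Rightarrow> (real ^ 'n2) \<times> real \<Rightarrow> (real ^ 'm2) \<times> real"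
  where "certificate_image c2 W2 \<xi> = (\<lambda>(y, s). (W2 \<xi> *v y, c2 \<xi> \<bullet> y + s))"

text \<open>The distance is finite, convex and continuous at every design, also where no certificate
  exists and the least recourse cost would be infinite.\<close>

definition constraint_gap ::
  "real ^ 'n1 \<Rightarrow> ('s \<Rightarrow> real ^ 'n2) \<Rightarrow> ('s \<Rightarrow> real ^ 'n1 ^ 'm2) \<Rightarrow> ('s \<Rightarrow> real ^ 'n2 ^ 'm2)
    \<Rightarrow> ('s \<Rightarrow> real ^ 'm2) \<Rightarrow> 's \<Rightarrow> (real ^ 'n1) \<times> real \<Rightarrow> real"
  where "constraint_gap c1 c2 T1 W2 h2 \<xi> z =
    infdist (h2 \<xi> - T1 \<xi> *v fst z, snd z - c1 \<bullet> fst z)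
      (certificate_image c2 W2 \<xi> ` {y. \<forall>b\<in>Basis. 0 \<le> y \<bullet> b})"

lemma nonneg_orthant_nonempty: "{x::'a::euclidean_space. \<forall>b\<in>Basis. 0 \<le> x \<bullet> b} \<noteq> {}"
proof -
  have "0 \<in> {x::'a. \<forall>b\<in>Basis. 0 \<le> x \<bullet> b}" by simp
  then show ?thesis by blast
qed

lemma nonneg_vec_iff_Basis:
  fixes x :: "real ^ 'n"
  shows "(\<forall>b\<in>Basis. 0 \<le> x \<bullet> b) \<longleftrightarrow> 0 \<le> x"
  by (auto simp: Basis_vec_def less_eq_vec_def inner_axis)

lemma linear_certificate_image: "linear (certificate_image c2 W2 \<xi>)"
  by (rule linearI)
    (auto simp: certificate_image_def algebra_simps inner_add_right matrix_vector_mult_scaleR)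

text \<open>Closedness of the image cone turns distance zero into membership, that is, into an
  actual certificate.\<close>

lemma constraint_gap_eq_0_iff:
  fixes c1 :: "real ^ 'n1" and c2 :: "'s \<Rightarrow> real ^ 'n2" and T1 :: "'s \<Rightarrow> real ^ 'n1 ^ 'm2"
    and W2 :: "'s \<Rightarrow> real ^ 'n2 ^ 'm2" and h2 :: "'s \<Rightarrow> real ^ 'm2"
  shows   "constraint_gap c1 c2 T1 W2 h2 \<xi> (x, \<gamma>) = 0 \<longleftrightarrow> (\<exists>y. is_certificate c1 c2 T1 W2 h2 \<xi> x \<gamma> y)"
proof -
  let ?C = "certificate_image c2 W2 \<xi> ` {y. \<forall>b\<in>Basis. 0 \<le> y \<bullet> b}"
  have orth: "{y::(real ^ 'n2) \<times> real. \<forall>b\<in>Basis. 0 \<le> y \<bullet> b} = {(y, s). 0 \<le> y \<and> 0 \<le> s}"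
    by (auto simp: Basis_prod_def nonneg_vec_iff_Basis[symmetric])
  have "closed ?C"
    by (rule closed_linear_image_nonneg_orthant[OF linear_certificate_image])
  moreover have "?C \<noteq> {}"
    using nonneg_orthant_nonempty by (simp only: image_is_empty not_False_eq_True)
  ultimately have "constraint_gap c1 c2 T1 W2 h2 \<xi> (x, \<gamma>) = 0 \<longleftrightarrow>
      (h2 \<xi> - T1 \<xi> *v x, \<gamma> - c1 \<bullet> x) \<in> ?C"
    by (simp add: constraint_gap_def in_closed_iff_infdist_zero)
  also have "\<dots> \<longleftrightarrow> (\<exists>y. is_certificate c1 c2 T1 W2 h2 \<xi> x \<gamma> y)"
  proof
    assume "(h2 \<xi> - T1 \<xi> *v x, \<gamma> - c1 \<bullet> x) \<in> ?C"
    then obtain y s where "h2 \<xi> - T1 \<xi> *v x = W2 \<xi> *v y" "\<gamma> - c1 \<bullet> x = c2 \<xi> \<bullet> y + s" "0 \<le> y" "0 \<le> s"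
      unfolding orth by (auto simp: certificate_image_def)
    then have "is_certificate c1 c2 T1 W2 h2 \<xi> x \<gamma> y"
      by (auto simp: is_certificate_def algebra_simps)
    then show "\<exists>y. is_certificate c1 c2 T1 W2 h2 \<xi> x \<gamma> y" ..
  next
    assume "\<exists>y. is_certificate c1 c2 T1 W2 h2 \<xi> x \<gamma> y"
    then obtain y where y: "is_certificate c1 c2 T1 W2 h2 \<xi> x \<gamma> y" ..
    then have "h2 \<xi> = T1 \<xi> *v x + W2 \<xi> *v y" by (simp add: is_certificate_def)
    then have "(h2 \<xi> - T1 \<xi> *v x, \<gamma> - c1 \<bullet> x)
        = certificate_image c2 W2 \<xi> (y, \<gamma> - c1 \<bullet> x - c2 \<xi> \<bullet> y)"
      by (simp add: certificate_image_def)
    moreover have "(y, \<gamma> - c1 \<bullet> x - c2 \<xi> \<bullet> y) \<in> {(y, s). 0 \<le> y \<and> 0 \<le> s}"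
      using y by (auto simp: is_certificate_def)
    ultimately show "(h2 \<xi> - T1 \<xi> *v x, \<gamma> - c1 \<bullet> x) \<in> ?C"
      unfolding orth by blast
  qed
  finally show ?thesis .
qed

lemma constraint_gap_nonneg: "0 \<le> constraint_gap c1 c2 T1 W2 h2 \<xi> z"
  by (simp add: constraint_gap_def infdist_nonneg)

text \<open>The point whose distance is taken depends affinely on \<open>z\<close>, and the distance
  from a convex set is convex.\<close>

lemma convex_on_constraint_gap:
  fixes c1 :: "real ^ 'n1" and c2 :: "'s \<Rightarrow> real ^ 'n2" and T1 :: "'s \<Rightarrow> real ^ 'n1 ^ 'm2"
    and W2 :: "'s \<Rightarrow> real ^ 'n2 ^ 'm2" and h2 :: "'s \<Rightarrow> real ^ 'm2"
  shows "convex_on UNIV (constraint_gap c1 c2 T1 W2 h2 \<xi>)"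
proof (rule convex_onI)
  let ?C = "certificate_image c2 W2 \<xi> ` {y. \<forall>b\<in>Basis. 0 \<le> y \<bullet> b}"
  define p where "p = (\<lambda>z. (h2 \<xi> - T1 \<xi> *v fst z, snd z - c1 \<bullet> fst z))"
  have "convex {y::(real ^ 'n2) \<times> real. \<forall>b\<in>Basis. 0 \<le> y \<bullet> b}"
    unfolding nonneg_orthant_eq_cone_hull by (rule convex_convex_cone_hull)
  then have conv: "convex_on UNIV (\<lambda>p. infdist p ?C)"
    using nonneg_orthant_nonempty
    by (intro convex_on_infdist convex_linear_image linear_certificate_image)
      (simp_all only: image_is_empty not_False_eq_True)
  fix t :: real and y z :: "(real ^ 'n1) \<times> real"
  assume t: "0 < t" "t < 1"
  have "p ((1 - t) *\<^sub>R y + t *\<^sub>R z) = (1 - t) *\<^sub>R p y + t *\<^sub>R p z"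
    by (simp add: p_def algebra_simps matrix_vector_mult_scaleR inner_add_right)
  then show "constraint_gap c1 c2 T1 W2 h2 \<xi> ((1 - t) *\<^sub>R y + t *\<^sub>R z)
      \<le> (1 - t) * constraint_gap c1 c2 T1 W2 h2 \<xi> y + t * constraint_gap c1 c2 T1 W2 h2 \<xi> z"
    using convex_onD[OF conv, of t "p y" "p z"] t by (simp add: constraint_gap_def p_def)
qed simp

lemma continuous_on_constraint_gap: "continuous_on UNIV (constraint_gap c1 c2 T1 W2 h2 \<xi>)"
  unfolding constraint_gap_def
  by (intro continuous_intros continuous_on_compose2[OF matrix_vector_mult_linear_continuous_on[of UNIV]]) auto

lemma constraint_gap_measurable:
  fixes c1 :: "real ^ 'n1" and c2 :: "'s \<Rightarrow> real ^ 'n2" and T1 :: "'s \<Rightarrow> real ^ 'n1 ^ 'm2"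
    and W2 :: "'s \<Rightarrow> real ^ 'n2 ^ 'm2" and h2 :: "'s \<Rightarrow> real ^ 'm2"
  assumes [measurable]: "c2 \<in> borel_measurable P" "h2 \<in> borel_measurable P"
    "T1 \<in> borel_measurable P" "W2 \<in> borel_measurable P"
  shows "(\<lambda>(\<xi>, z). constraint_gap c1 c2 T1 W2 h2 \<xi> z) \<in> borel_measurable (P \<Otimes>\<^sub>M borel)"
proof -
  have [measurable]: "fst \<in> borel_measurable (borel :: ((real ^ 'n1) \<times> real) measure)"
    "snd \<in> borel_measurable (borel :: ((real ^ 'n1) \<times> real) measure)"
    by (auto intro!: borel_measurable_continuous_onI continuous_intros)
  show ?thesis
    unfolding constraint_gap_def split_beta
  proof (rule infdist_measurable_image)
    show "(\<lambda>w. (h2 (fst w) - T1 (fst w) *v fst (snd w), snd (snd w) - c1 \<bullet> fst (snd w)))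
        \<in> borel_measurable (P \<Otimes>\<^sub>M borel)"
      by (intro borel_measurable_Pair) measurable
    show "(\<lambda>w. certificate_image c2 W2 (fst w) y) \<in> borel_measurable (P \<Otimes>\<^sub>M borel)" for y
      unfolding certificate_image_def split_beta by (intro borel_measurable_Pair) measurable
    show "continuous_on UNIV (certificate_image c2 W2 (fst w))" for w
      by (intro linear_continuous_on linear_conv_bounded_linear[THEN iffD1] linear_certificate_image)
  qed (rule nonneg_orthant_nonempty)
qed

section \<open>The relaxed scenario program\<close>

lemma (in random_constraints) violation_set_measurable:
  assumes S: "finite S"
  shows "{\<omega> \<in> space (PiM S (\<lambda>_. M)). \<epsilon> < prob {q \<in> space M. 0 < g q (sol S \<omega>)}} \<in> sets (PiM S (\<lambda>_. M))"
proof -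
  note [measurable] = sol_measurable[OF S subset_refl]
  have "(\<lambda>\<omega>. enn2real (\<integral>\<^sup>+q. (if 0 < g q (sol S \<omega>) then 1 else 0) \<partial>M)) \<in> borel_measurable (PiM S (\<lambda>_. M))"
    by measurable
  also have "?this \<longleftrightarrow> (\<lambda>\<omega>. prob {q \<in> space M. 0 < g q (sol S \<omega>)}) \<in> borel_measurable (PiM S (\<lambda>_. M))"
  proof (intro measurable_cong)
    fix \<omega>
    have "{q \<in> space M. 0 < g q (sol S \<omega>)} \<in> sets M" by measurable
    moreover have "(\<integral>\<^sup>+q. (if 0 < g q (sol S \<omega>) then 1 else 0) \<partial>M)
        = (\<integral>\<^sup>+q. indicator {q \<in> space M. 0 < g q (sol S \<omega>)} q \<partial>M)"
      by (intro nn_integral_cong) (auto simp: indicator_def)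
    ultimately show "enn2real (\<integral>\<^sup>+q. (if 0 < g q (sol S \<omega>) then 1 else 0) \<partial>M)
        = prob {q \<in> space M. 0 < g q (sol S \<omega>)}"
      by (simp add: measure_def)
  qed
  finally have [measurable]:
    "(\<lambda>\<omega>. prob {q \<in> space M. 0 < g q (sol S \<omega>)}) \<in> borel_measurable (PiM S (\<lambda>_. M))" .
  show ?thesis by measurable
qed

locale scenario_program =
  fixes \<Xi> :: "(real ^ 'n1) set"
    and P :: "(real ^ 'n1) measure"
    and A :: "real ^ 'n1 ^ 'm1"
    and h1 :: "real ^ 'm1"
    and c1 :: "real ^ 'n1"
    and c2 :: "real ^ 'n1 \<Rightarrow> real ^ 'n2"
    and h2 :: "real ^ 'n1 \<Rightarrow> real ^ 'm2"
    and T1 :: "real ^ 'n1 \<Rightarrow> real ^ 'n1 ^ 'm2"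
    and W2 :: "real ^ 'n1 \<Rightarrow> real ^ 'n2 ^ 'm2"
    and N :: nat
  assumes P_prob: "prob_space P"
    and P_sets: "sets P = sets (restrict_space borel \<Xi>)"
    and c2_meas: "c2 \<in> borel_measurable P"
    and h2_meas: "h2 \<in> borel_measurable P"
    and T1_meas: "T1 \<in> borel_measurable P"
    and W2_meas: "W2 \<in> borel_measurable P"
    and N_gt: "N > CARD('n1)"
    and unique_optimum:
      "\<And>\<omega>. \<omega> \<in> {1..N} \<rightarrow>\<^sub>E \<Xi> \<Longrightarrow>
         \<exists>!z. SwC_optimal_design A h1 c1 c2 T1 W2 h2 N \<omega> z"
begin

definition X :: "((real ^ 'n1) \<times> real) set" where
  "X = {z. A *v fst z = h1 \<and> 0 \<le> fst z}"

abbreviation gap :: "real ^ 'n1 \<Rightarrow> (real ^ 'n1) \<times> real \<Rightarrow> real" where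
  "gap \<equiv> constraint_gap c1 c2 T1 W2 h2"

text \<open>The law has no atoms. Its space is all of \<open>real\<close>, so
  \<open>relaxed_gap\<close> takes the absolute value of a label to make the relaxation nonnegative
  everywhere.\<close>

definition label :: "real measure" where
  "label = uniform_measure lborel {0..1}"

definition Q :: "((real ^ 'n1) \<times> real) measure" where
  "Q = P \<Otimes>\<^sub>M label"

text \<open>Relaxing each sampled constraint by a random amount makes the support constraints of the
  optimum almost surely unique.\<close>

definition relaxed_gap :: "nat \<Rightarrow> (real ^ 'n1) \<times> real \<Rightarrow> (real ^ 'n1) \<times> real \<Rightarrow> real" where
  "relaxed_gap n q z = gap (fst q) z - \<bar>snd q\<bar> / real (Suc n)"

lemma space_P: "space P = \<Xi>"
  using sets_eq_imp_space_eq[OF P_sets] by (simp add: space_restrict_space)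

lemma gap_le_0_iff: "gap \<xi> (x, \<gamma>) \<le> 0 \<longleftrightarrow> (\<exists>y. is_certificate c1 c2 T1 W2 h2 \<xi> x \<gamma> y)"
  using constraint_gap_nonneg[of c1 c2 T1 W2 h2 \<xi> "(x, \<gamma>)"]
  by (simp flip: constraint_gap_eq_0_iff)

lemma feasible_iff:
  "(\<exists>x2. SwC_feasible A h1 c1 c2 T1 W2 h2 N \<omega> x \<gamma> x2) \<longleftrightarrow>
     (x, \<gamma>) \<in> X \<and> (\<forall>i\<in>{1..N}. gap (\<omega> i) (x, \<gamma>) \<le> 0)"
  by (auto simp: SwC_feasible_def X_def gap_le_0_iff bchoice_iff)

lemma optimal_design_iff:
  "SwC_optimal_design A h1 c1 c2 T1 W2 h2 N \<omega> z \<longleftrightarrow>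
     z \<in> X \<and> (\<forall>i\<in>{1..N}. gap (\<omega> i) z \<le> 0) \<and>
     (\<forall>y\<in>X. (\<forall>i\<in>{1..N}. gap (\<omega> i) y \<le> 0) \<longrightarrow> snd z \<le> snd y)"
proof -
  obtain x \<gamma> where z: "z = (x, \<gamma>)" by (cases z)
  have "SwC_optimal_design A h1 c1 c2 T1 W2 h2 N \<omega> z \<longleftrightarrow>
      (\<exists>x2. SwC_feasible A h1 c1 c2 T1 W2 h2 N \<omega> x \<gamma> x2) \<and>
      (\<forall>y1 \<delta>. (\<exists>y2. SwC_feasible A h1 c1 c2 T1 W2 h2 N \<omega> y1 \<delta> y2) \<longrightarrow> \<gamma> \<le> \<delta>)"
    by (auto simp: SwC_optimal_design_def SwC_optimal_def z)
  then show ?thesis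
    by (auto simp: feasible_iff z)
qed

lemma closed_X: "closed X"
proof -
  have "X = fst -` {x. A *v x = h1} \<inter> fst -` (\<Inter>i. {x. 0 \<le> x $ i})"
    by (auto simp: X_def less_eq_vec_def)
  moreover have "closed {x. A *v x = h1}"
    by (intro closed_Collect_eq continuous_intros)
  moreover have "closed (\<Inter>i. {x :: real ^ 'n1. 0 \<le> x $ i})"
    by (intro closed_INT ballI closed_Collect_le continuous_intros)
  ultimately show ?thesis
    by (simp only:) (intro closed_Int closed_vimage_fst)
qed

lemma convex_X: "convex X"
proof (rule convexI)
  fix y z and s t :: real
  assume yz: "y \<in> X" "z \<in> X" and st: "0 \<le> s" "0 \<le> t" "s + t = 1"
  have "A *v (s *\<^sub>R fst y + t *\<^sub>R fst z) = (s + t) *\<^sub>R h1"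
    using yz by (simp add: X_def matrix_vector_right_distrib matrix_vector_mult_scaleR scaleR_left_distrib)
  then show "s *\<^sub>R y + t *\<^sub>R z \<in> X"
    using yz st by (simp add: X_def less_eq_vec_def)
qed

text \<open>The moment argument needs feasible samples of arbitrary size, while the hypothesis
  concerns samples of size \<open>N\<close>. Projecting out \<open>\<gamma>\<close> leaves convex
  sets in dimension \<open>CARD('n1)\<close>, so Helly's theorem asks only for
  \<open>CARD('n1) + 1 \<le> N\<close> constraints at a time.\<close>

lemma finite_feasible:
  fixes J :: "nat set"
  assumes J: "finite J" "J \<noteq> {}" and \<xi>: "\<And>i. i \<in> J \<Longrightarrow> \<xi> i \<in> \<Xi>"
  shows "\<exists>z\<in>X. \<forall>i\<in>J. gap (\<xi> i) z \<le> 0"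
proof -
  define C where "C = (\<lambda>i. fst ` (X \<inter> {z. gap (\<xi> i) z \<le> 0}))"
  have convC: "convex (C i)" for i
    unfolding C_def
    by (intro convex_linear_image convex_Int convex_X convex_sublevel convex_on_constraint_gap linear_fst)
  have "(\<Inter>i\<in>J. C i) \<noteq> {}"
  proof (rule Helly_indexed[OF J(1) convC])
    fix J' assume J': "J' \<subseteq> J" "card J' \<le> DIM(real ^ 'n1) + 1"
    show "(\<Inter>i\<in>J'. C i) \<noteq> {}"
    proof (cases "J' = {}")
      case False
      then obtain j where j: "j \<in> J'" by auto
      have finJ': "finite J'" using J J' finite_subset by auto
      have "card J' \<le> card {1..N}" using J' N_gt by simp
      then obtain f where f: "inj_on f J'" "f ` J' \<subseteq> {1..N}"
        using card_le_inj[OF finJ', of "{1..N}"] by auto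
      define s where "s = (\<lambda>k. if k \<in> f ` J' then inv_into J' f k else j)"
      have sJ: "s k \<in> J'" for k
        using j by (auto simp: s_def inv_into_into)
      have sf: "s (f i) = i" if "i \<in> J'" for i
        using f that by (auto simp: s_def)
      define \<omega> where "\<omega> = (\<lambda>k\<in>{1..N}. \<xi> (s k))"
      have "\<omega> \<in> {1..N} \<rightarrow>\<^sub>E \<Xi>"
        using sJ J' \<xi> by (auto simp: \<omega>_def)
      then obtain z where "SwC_optimal_design A h1 c1 c2 T1 W2 h2 N \<omega> z"
        using unique_optimum by blast
      then have z: "z \<in> X" "\<And>k. k \<in> {1..N} \<Longrightarrow> gap (\<omega> k) z \<le> 0"
        by (auto simp: optimal_design_iff)
      have "gap (\<xi> i) z \<le> 0" if "i \<in> J'" for i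
      proof -
        have "f i \<in> {1..N}" using f that by auto
        from z(2)[OF this] show ?thesis
          using \<open>f i \<in> {1..N}\<close> sf[OF that] by (simp only: \<omega>_def restrict_apply if_True)
      qed
      then have "fst z \<in> (\<Inter>i\<in>J'. C i)"
        using z(1) by (auto simp: C_def)
      then show ?thesis by blast
    qed simp
  qed
  then obtain x where "\<And>i. i \<in> J \<Longrightarrow> x \<in> C i" by auto
  then have "\<forall>i\<in>J. \<exists>\<gamma>. (x, \<gamma>) \<in> X \<and> gap (\<xi> i) (x, \<gamma>) \<le> 0"
    by (force simp: C_def)
  then obtain \<gamma> where \<gamma>: "\<And>i. i \<in> J \<Longrightarrow> (x, \<gamma> i) \<in> X" "\<And>i. i \<in> J \<Longrightarrow> gap (\<xi> i) (x, \<gamma> i) \<le> 0"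
    by metis
  \<comment> \<open>Each constraint weakens as \<open>\<gamma>\<close> grows, so the largest of the
    finitely many values serves all samples.\<close>
  define m where "m = Max (\<gamma> ` J)"
  have "gap (\<xi> i) (x, m) \<le> 0" if "i \<in> J" for i
  proof -
    have "\<gamma> i \<le> m" unfolding m_def using J that by (intro Max_ge) auto
    then show ?thesis
      using \<gamma>(2)[OF that] by (auto simp: gap_le_0_iff is_certificate_def intro: order_trans)
  qed
  moreover have "(x, m) \<in> X"
    using \<gamma>(1) J(2) by (auto simp: X_def)
  ultimately show ?thesis by blast
qed

section \<open>Labelled samples and their relaxed constraints\<close>

lemma prob_space_label: "prob_space label"
  unfolding label_def by (intro prob_space_uniform_measure) auto

lemma space_label [simp]: "space label = UNIV" and sets_label [measurable_cong]: "sets label = sets borel"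
  by (simp_all add: label_def)

lemma AE_label_finite:
  assumes "finite F"
  shows "AE u in label. u \<notin> F"
proof -
  have "AE u in lborel. u \<notin> F"
    using assms by (intro AE_not_in finite_imp_null_set_lborel)
  then show ?thesis
    unfolding label_def by (subst AE_uniform_measure) (auto elim!: eventually_mono)
qed

lemma prob_space_Q: "prob_space Q"
  unfolding Q_def by (intro prob_space_pair P_prob prob_space_label)

lemma AE_Q_I:
  assumes "Measurable.pred Q (\<lambda>q. R (fst q) (snd q))"
    and "\<And>\<xi>. \<xi> \<in> space P \<Longrightarrow> AE u in label. R \<xi> u"
  shows "AE q in Q. R (fst q) (snd q)"
proof -
  interpret P: prob_space P by (rule P_prob)
  interpret L: prob_space label by (rule prob_space_label)
  interpret PL: pair_sigma_finite P label ..
  show ?thesis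
    using assms unfolding Q_def by (intro PL.AE_pair_measure) (auto simp: pred_def)
qed

lemma random_constraints_relaxed: "random_constraints Q X (relaxed_gap n) snd"
proof -
  interpret prob_space Q by (rule prob_space_Q)
  have gap[measurable]: "(\<lambda>(\<xi>, z). gap \<xi> z) \<in> borel_measurable (P \<Otimes>\<^sub>M borel)"
    by (rule constraint_gap_measurable[OF c2_meas h2_meas T1_meas W2_meas])
  have rel: "(\<lambda>(q, z). relaxed_gap n q z) \<in> borel_measurable (Q \<Otimes>\<^sub>M borel)"
    unfolding relaxed_gap_def Q_def by measurable
  show ?thesis
  proof
    show "closed X" "convex X" by (fact closed_X convex_X)+
    show "convex_on UNIV (relaxed_gap n q)" for q
      using convex_on_add[OF convex_on_constraint_gap[of c1 c2 T1 W2 h2 "fst q"],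
          of "\<lambda>_. - (\<bar>snd q\<bar> / real (Suc n))"]
      by (simp add: relaxed_gap_def[abs_def] convex_on_const)
    show "continuous_on UNIV (relaxed_gap n q)" for q
      unfolding relaxed_gap_def[abs_def]
      by (intro continuous_intros continuous_on_constraint_gap)
    show "(\<lambda>(q, z). relaxed_gap n q z) \<in> borel_measurable (Q \<Otimes>\<^sub>M borel)" by (rule rel)
    show "snd \<in> borel_measurable Q" unfolding Q_def by measurable
    show "X \<inter> {z. \<forall>i\<in>J. relaxed_gap n (\<omega> i) z \<le> 0} \<noteq> {}"
      if J: "finite J" "\<And>i. i \<in> J \<Longrightarrow> \<omega> i \<in> space Q" for J :: "nat set" and \<omega>
    proof -
      interpret P: prob_space P by (rule P_prob)
      obtain \<xi>0 where \<xi>0: "\<xi>0 \<in> \<Xi>" using P.not_empty space_P by auto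
      \<comment> \<open>The default \<open>\<xi>0\<close> and the extra index \<open>0\<close> below
        give \<open>finite_feasible\<close> a nonempty index set even if \<open>J\<close> is
        empty.\<close>
      define \<xi> where "\<xi> = (\<lambda>i. if i \<in> J then fst (\<omega> i) else \<xi>0)"
      have "\<xi> i \<in> \<Xi>" for i
        using J(2)[of i] \<xi>0 by (auto simp: \<xi>_def Q_def space_pair_measure space_P)
      then obtain z where z: "z \<in> X" "\<forall>i\<in>insert 0 J. gap (\<xi> i) z \<le> 0"
        using finite_feasible[of "insert 0 J" \<xi>] J by auto
      have "relaxed_gap n (\<omega> i) z \<le> 0" if "i \<in> J" for i
      proof -
        have "gap (fst (\<omega> i)) z \<le> 0" using z that by (auto simp: \<xi>_def split: if_splits)
        moreover have "0 \<le> \<bar>snd (\<omega> i)\<bar> / real (Suc n)" by simp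
        ultimately show ?thesis unfolding relaxed_gap_def by linarith
      qed
      then show ?thesis using z(1) by auto
    qed
    show "AE q in Q. relaxed_gap n q z \<noteq> 0" for z
      unfolding relaxed_gap_def
    proof (rule AE_Q_I[where R = "\<lambda>\<xi> u. gap \<xi> z - \<bar>u\<bar> / real (Suc n) \<noteq> 0"])
      show "Measurable.pred Q (\<lambda>q. gap (fst q) z - \<bar>snd q\<bar> / real (Suc n) \<noteq> 0)"
      proof -
        have "(\<lambda>q. (fst q, z)) \<in> measurable Q (P \<Otimes>\<^sub>M borel)"
          unfolding Q_def by measurable
        from measurable_compose[OF this gap]
        have [measurable]: "(\<lambda>q. gap (fst q) z) \<in> borel_measurable Q" by simp
        have [measurable]: "snd \<in> borel_measurable Q" unfolding Q_def by measurable
        show ?thesis by measurable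
      qed
      fix \<xi>
      \<comment> \<open>For a fixed sample the relaxed constraint can be active at \<open>z\<close>
        only for the two label values \<open>?c\<close> and \<open>- ?c\<close>.\<close>
      let ?c = "gap \<xi> z * real (Suc n)"
      have "AE u in label. u \<notin> {?c, - ?c}" by (intro AE_label_finite) auto
      then show "AE u in label. gap \<xi> z - \<bar>u\<bar> / real (Suc n) \<noteq> 0"
        by eventually_elim (auto simp: field_simps abs_if split: if_splits)
    qed
    show "AE q in Q. snd q \<noteq> c" for c
    proof (rule AE_Q_I[where R = "\<lambda>_ u. u \<noteq> c"])
      have [measurable]: "snd \<in> borel_measurable Q" unfolding Q_def by measurable
      show "Measurable.pred Q (\<lambda>q. snd q \<noteq> c)" by measurable
      show "AE u in label. u \<noteq> c" using AE_label_finite[of "{c}"] by simp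
    qed
  qed
qed

lemma relaxed_solution_tendsto:
  assumes \<omega>: "\<And>i. i \<in> {1..N} \<Longrightarrow> fst (\<omega> i) \<in> \<Xi>"
  shows "(\<lambda>n. random_constraints.sol X (0, - real (Suc n)) (relaxed_gap n) {1..N} \<omega>)
    \<longlonglongrightarrow> SwC_solution A h1 c1 c2 T1 W2 h2 N (\<lambda>i\<in>{1..N}. fst (\<omega> i))"
proof -
  let ?\<xi> = "\<lambda>i\<in>{1..N}. fst (\<omega> i)"
  let ?z = "SwC_solution A h1 c1 c2 T1 W2 h2 N ?\<xi>"
  have ex1: "\<exists>!z. SwC_optimal_design A h1 c1 c2 T1 W2 h2 N ?\<xi> z"
    using \<omega> by (intro unique_optimum) auto
  then have opt: "SwC_optimal_design A h1 c1 c2 T1 W2 h2 N ?\<xi> ?z"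
    unfolding SwC_solution_def by (rule theI')
  have *: "(\<forall>i\<in>{1..N}. gap (?\<xi> i) z \<le> 0) \<longleftrightarrow> (\<forall>i\<in>{1..N}. gap (fst (\<omega> i)) z \<le> 0)" for z
    by simp
  have "(\<lambda>n. closest_point (X \<inter> {y. \<forall>i\<in>{1..N}. gap (fst (\<omega> i)) y - \<bar>snd (\<omega> i)\<bar> / real (Suc n) \<le> 0})
      (0, - real (Suc n))) \<longlonglongrightarrow> ?z"
  proof (rule relaxed_minimiser_tendsto)
    show "?z \<in> X" "\<And>i. i \<in> {1..N} \<Longrightarrow> gap (fst (\<omega> i)) ?z \<le> 0"
      using opt unfolding optimal_design_iff * by blast+
    fix y assume y: "y \<in> X" "\<And>i. i \<in> {1..N} \<Longrightarrow> gap (fst (\<omega> i)) y \<le> 0" "snd y \<le> snd ?z"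
    then have "SwC_optimal_design A h1 c1 c2 T1 W2 h2 N ?\<xi> y"
      using opt unfolding optimal_design_iff * by (blast intro: order_trans)
    with ex1 opt show "y = ?z" by blast
  qed (auto intro: closed_X convex_X convex_on_constraint_gap continuous_on_constraint_gap)
  then show ?thesis
    by (simp only: random_constraints.sol_def[OF random_constraints_relaxed] relaxed_gap_def)
qed

text \<open>The bound holds for every relaxed program. A labelled sample in the bad event lies in
  all but finitely many relaxed bad events \<open>B n\<close>, so a bad event of probability above
  the bound would force some \<open>B n\<close> above it too.\<close>

theorem violation_tail:
  assumes \<epsilon>: "0 < \<epsilon>" "\<epsilon> < 1"
  shows "measure (PiM {1..N} (\<lambda>_. P))
      {\<omega> \<in> space (PiM {1..N} (\<lambda>_. P)).
        violation_prob P c1 c2 T1 W2 h2 (SwC_solution A h1 c1 c2 T1 W2 h2 N \<omega>) > \<epsilon>}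
    \<le> binomial_tail N \<epsilon> (CARD('n1) + 1)"
    (is "measure _ ?E \<le> ?b")
proof (rule ccontr)
  assume contr: "\<not> measure (PiM {1..N} (\<lambda>_. P)) ?E \<le> ?b"
  have b0: "0 \<le> ?b"
    unfolding binomial_tail_def using \<epsilon> by (intro sum_nonneg) auto
  \<comment> \<open>A nonmeasurable event has \<open>measure\<close> equal to \<open>0\<close>,
    which is within the bound.\<close>
  have E: "?E \<in> sets (PiM {1..N} (\<lambda>_. P))"
    using contr b0 measure_notin_sets by fastforce
  let ?QN = "PiM {1..N} (\<lambda>_. Q)"
  interpret P: prob_space P by (rule P_prob)
  interpret Q: prob_space Q by (rule prob_space_Q)
  interpret L: prob_space label by (rule prob_space_label)
  interpret QN: prob_space ?QN by (intro prob_space_PiM prob_space_Q)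
  define sol where "sol n = random_constraints.sol X (0, - real (Suc n)) (relaxed_gap n) {1..N}" for n
  define B where "B n = {\<omega> \<in> space ?QN. \<epsilon> < Q.prob {q \<in> space Q. 0 < relaxed_gap n q (sol n \<omega>)}}" for n
  have fstQ[measurable]: "fst \<in> measurable Q P" unfolding Q_def by measurable
  have distr: "distr Q P fst = P" unfolding Q_def by (rule L.distr_pair_fst)
  have distrN: "distr ?QN (PiM {1..N} (\<lambda>_. P)) (compose {1..N} fst) = PiM {1..N} (\<lambda>_. P)"
    using distr_PiM_finite_prob_space'[of "{1..N}" "\<lambda>_. Q" "\<lambda>_. P" fst]
    by (simp add: prob_space_Q P_prob distr)
  have compose[measurable]: "compose {1..N} fst \<in> measurable ?QN (PiM {1..N} (\<lambda>_. P))"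
    unfolding compose_def by measurable
  \<comment> \<open>The bad event is lifted to labelled samples; forgetting the labels maps their
    law to that of the original sample, so its probability is unchanged.\<close>
  define E' where "E' = compose {1..N} fst -` ?E \<inter> space ?QN"
  have E': "E' \<in> sets ?QN" unfolding E'_def using compose E by (rule measurable_sets)
  have "QN.prob E' = measure (PiM {1..N} (\<lambda>_. P)) ?E"
    unfolding E'_def by (subst (2) distrN[symmetric]) (use compose E in \<open>rule measure_distr[symmetric]\<close>)
  then have gt: "?b < QN.prob E'" using contr by simp
  have tail: "QN.prob (B n) \<le> ?b" and Bset: "B n \<in> sets ?QN" for n
  proof -
    interpret R: random_constraints Q X "(0, - real (Suc n))" "relaxed_gap n" snd
      by (rule random_constraints_relaxed)
    show "QN.prob (B n) \<le> ?b"
      using R.violation_tail[of "{1..N}" \<epsilon>] N_gt \<epsilon> by (simp add: B_def sol_def)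
    show "B n \<in> sets ?QN"
      unfolding B_def sol_def by (rule R.violation_set_measurable) simp
  qed
  have "\<forall>\<^sub>F n in sequentially. ?b < QN.prob (B n)"
  proof (rule QN.eventually_measure_gt[OF E' Bset _ gt])
    fix \<omega> assume "\<omega> \<in> E'"
    then have \<omega>: "\<omega> \<in> space ?QN" and viol: "compose {1..N} fst \<omega> \<in> ?E"
      by (auto simp: E'_def)
    define z where "z = SwC_solution A h1 c1 c2 T1 W2 h2 N (compose {1..N} fst \<omega>)"
    have "fst (\<omega> i) \<in> \<Xi>" if "i \<in> {1..N}" for i
      using \<omega> that by (auto simp: space_PiM Q_def space_pair_measure space_P PiE_iff mem_Times_iff)
    then have lim: "(\<lambda>n. sol n \<omega>) \<longlonglongrightarrow> z"
      unfolding z_def sol_def compose_def by (rule relaxed_solution_tendsto)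
    have meas_gap: "{\<xi> \<in> space P. 0 < gap \<xi> z} \<in> sets P"
    proof -
      have "(\<lambda>\<xi>. gap \<xi> z) \<in> borel_measurable P"
        using measurable_compose[OF measurable_Pair2'[of z borel P] constraint_gap_measurable[OF c2_meas h2_meas T1_meas W2_meas]]
        by simp
      then show ?thesis by measurable
    qed
    have "\<epsilon> < violation_prob P c1 c2 T1 W2 h2 z"
      using viol by (simp add: z_def)
    also have "violation_prob P c1 c2 T1 W2 h2 z = P.prob {\<xi> \<in> space P. 0 < gap \<xi> z}"
      by (cases z) (simp add: violation_prob_def gap_le_0_iff[symmetric] not_le)
    also have "\<dots> = measure (distr Q P fst) {\<xi> \<in> space P. 0 < gap \<xi> z}"
      by (simp add: distr)
    also have "\<dots> = Q.prob (fst -` {\<xi> \<in> space P. 0 < gap \<xi> z} \<inter> space Q)"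
      by (rule measure_distr[OF fstQ meas_gap])
    \<comment> \<open>The limit principle applied above to the multisample is applied here to the
      new sample \<open>q\<close>: a positive gap at \<open>z\<close> is inherited by late relaxed
      optima, since the gap is continuous and the relaxation vanishes.\<close>
    finally have "\<forall>\<^sub>F n in sequentially. \<epsilon> < Q.prob {q \<in> space Q. 0 < relaxed_gap n q (sol n \<omega>)}"
    proof (rule Q.eventually_measure_gt[rotated -1])
      show "fst -` {\<xi> \<in> space P. 0 < gap \<xi> z} \<inter> space Q \<in> sets Q"
        using fstQ meas_gap by (rule measurable_sets)
      show "{q \<in> space Q. 0 < relaxed_gap n q (sol n \<omega>)} \<in> sets Q" for n
      proof -
        interpret R: random_constraints Q X "(0, - real (Suc n))" "relaxed_gap n" snd
          by (rule random_constraints_relaxed)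
        have "(\<lambda>q. relaxed_gap n q (sol n \<omega>)) \<in> borel_measurable Q"
          by (rule R.g_measurable') simp_all
        then show ?thesis by measurable
      qed
      fix q assume q: "q \<in> fst -` {\<xi> \<in> space P. 0 < gap \<xi> z} \<inter> space Q"
      have "(\<lambda>n. gap (fst q) (sol n \<omega>)) \<longlonglongrightarrow> gap (fst q) z"
        by (rule continuous_on_tendsto_compose[OF continuous_on_constraint_gap lim]) simp_all
      moreover have "(\<lambda>n. \<bar>snd q\<bar> * inverse (real (Suc n))) \<longlonglongrightarrow> 0"
        by (intro tendsto_mult_right_zero LIMSEQ_inverse_real_of_nat)
      ultimately have "(\<lambda>n. relaxed_gap n q (sol n \<omega>)) \<longlonglongrightarrow> gap (fst q) z - 0"
        unfolding relaxed_gap_def divide_inverse by (rule tendsto_diff)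
      then have "\<forall>\<^sub>F n in sequentially. 0 < relaxed_gap n q (sol n \<omega>)"
        by (rule order_tendstoD(1)) (use q in simp)
      then show "\<forall>\<^sub>F n in sequentially. q \<in> {q \<in> space Q. 0 < relaxed_gap n q (sol n \<omega>)}"
        by (rule eventually_mono) (use q in simp)
    qed
    then show "\<forall>\<^sub>F n in sequentially. \<omega> \<in> B n"
      by (rule eventually_mono) (use \<omega> in \<open>simp add: B_def\<close>)
  qed
  then obtain n where "?b < QN.prob (B n)"
    by (auto simp: eventually_sequentially)
  with tail[of n] show False by linarith
qed

end

theorem theorem2:
  fixes \<Xi> :: "(real ^ 'n1) set"
    and P :: "(real ^ 'n1) measure"
    and A :: "real ^ 'n1 ^ 'm1"
    and h1 :: "real ^ 'm1"
    and c1 :: "real ^ 'n1"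
    and c2 :: "real ^ 'n1 \<Rightarrow> real ^ 'n2"
    and h2 :: "real ^ 'n1 \<Rightarrow> real ^ 'm2"
    and T1 :: "real ^ 'n1 \<Rightarrow> real ^ 'n1 ^ 'm2"
    and W2 :: "real ^ 'n1 \<Rightarrow> real ^ 'n2 ^ 'm2"
    and N :: nat
    and \<epsilon> :: real
  assumes P_prob: "prob_space P"
    and P_sets: "sets P = sets (restrict_space borel \<Xi>)"
    and c2_meas: "c2 \<in> borel_measurable P"
    and h2_meas: "h2 \<in> borel_measurable P"
    and T1_meas: "T1 \<in> borel_measurable P"
    and W2_meas: "W2 \<in> borel_measurable P"
    and N_gt: "N > CARD('n1)"
    and unique_optimum:
      "\<And>\<omega>. \<omega> \<in> {1..N} \<rightarrow>\<^sub>E \<Xi> \<Longrightarrow>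
         \<exists>!z. SwC_optimal_design A h1 c1 c2 T1 W2 h2 N \<omega> z"
    and eps: "0 < \<epsilon>" "\<epsilon> < 1"
  shows "measure (PiM {1..N} (\<lambda>_. P))
           {\<omega> \<in> space (PiM {1..N} (\<lambda>_. P)).
              violation_prob P c1 c2 T1 W2 h2 (SwC_solution A h1 c1 c2 T1 W2 h2 N \<omega>) > \<epsilon>}
         \<le> binomial_tail N \<epsilon> (CARD('n1) + 1)"
proof -
  interpret scenario_program \<Xi> P A h1 c1 c2 h2 T1 W2 N
    by (rule scenario_program.intro) fact+
  show ?thesis by (rule violation_tail[OF eps])
qed

end
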